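(* Let $\mu$ be an infinite cardinal, $\kappa=\mu^+$, and let $I$ be a $\kappa$-complete (proper, nonprincipal) ideal on $\kappa$. Then: (i) $I$ is $(\operatorname{cf}(\mu)+1,\kappa)$-regular, $I$ is $(1,\operatorname{cf}(\mu),\kappa)$-regular, and $I$ is $(2,\delta)$-regular for every $\delta<\kappa$; (ii) if $I$ is $(\operatorname{cf}(\mu),\kappa)$-regular, then $I$ is $(2,\kappa)$-regular; (iii) if $I$ is $(\alpha,\beta,\kappa)$-regular for some $\alpha,\beta<\kappa$ with $\mu^\beta=\mu$, then $I$ is $(2,\kappa)$-regular.
   Context: An ideal on a set $X$ is a family of subsets of $X$ closed under subsets and finite unions; it is $\kappa$-complete if closed under unions of fewer than $\kappa$ sets; all ideals are assumed proper ($X\notin I$) and nonprincipal ($\{x\}\in I$ for all $x\in X$). $I^+$ denotes the family of subsets of $X$ not in $I$. A sequence $\langle B_i\rangle$ is a refinement of $\langle A_i\rangle$ if $B_i\subseteq A_i$ for each $i$. For ordinals $\alpha,\beta$, an ideal $I$ is $(\alpha,\beta)$-regular if every sequence $\langle A_i:i<\beta\rangle\subseteq I^+$ has a refinement $\langle B_i:i<\beta\rangle\subseteq I^+$ such that $\bigcap_{i\in z}B_i=\emptyset$ for every $z\subseteq\beta$ of ordertype $\alpha$. For ordinals $\alpha,\beta,\gamma$, $I$ is $(\alpha,\beta,\gamma)$-regular if every sequence $\langle A_i:i<\gamma\rangle\subseteq I^+$ has a refinement $\langle B_i:i<\gamma\rangle\subseteq I^+$ such that $|\bigcap_{i\in x}B_i|\le\alpha$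 for every $x\subseteq\gamma$ of ordertype $\beta$. *)

theory Defs
  imports Main
begin

unbundle cardinal_syntax

text \<open>
  Ordinals are represented by well-orders, up to \<open>=o\<close>; infinite cardinals by relations satisfying
  \<^const>\<open>Cinfinite\<close>, i.e. infinite initial ordinals; \<open>natLeq_on n\<close> is the finite ordinal \<open>n\<close>.
\<close>

definition ordsuc :: "'a rel \<Rightarrow> 'a option rel" where
  "ordsuc r = {(Some a, Some b) | a b. (a, b) \<in> r} \<union> {(Some a, None) | a. a \<in> Field r} \<union> {(None, None)}"

text \<open>
  The cofinality is the least cardinality of a cofinal subset. The library predicate
  \<^const>\<open>cofinal\<close> asks for strict upper bounds, which makes no difference for the limit ordinals
  to which it is applied here.
\<close>

definition cf :: "'a rel \<Rightarrow> 'a rel" where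
  "cf r = (SOME c. \<exists>K. K \<subseteq> Field r \<and> cofinal K r \<and> c = |K| \<and>
      (\<forall>L. L \<subseteq> Field r \<and> cofinal L r \<longrightarrow> |K| \<le>o |L| ))"

definition ideal_on :: "'x set \<Rightarrow> 'x set set \<Rightarrow> bool" where
  "ideal_on X I \<longleftrightarrow> I \<subseteq> Pow X \<and> {} \<in> I
     \<and> (\<forall>A\<in>I. \<forall>B. B \<subseteq> A \<longrightarrow> B \<in> I)
     \<and> (\<forall>A\<in>I. \<forall>B\<in>I. A \<union> B \<in> I)"

definition proper_ideal :: "'x set \<Rightarrow> 'x set set \<Rightarrow> bool" where
  "proper_ideal X I \<longleftrightarrow> X \<notin> I"

definition nonprincipal_ideal :: "'x set \<Rightarrow> 'x set set \<Rightarrow> bool" where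
  "nonprincipal_ideal X I \<longleftrightarrow> (\<forall>x\<in>X. {x} \<in> I)"

definition complete_ideal :: "'k rel \<Rightarrow> 'x set set \<Rightarrow> bool" where
  "complete_ideal \<kappa> I \<longleftrightarrow> (\<forall>F. F \<subseteq> I \<and> |F| <o \<kappa> \<longrightarrow> \<Union>F \<in> I)"

definition positive_sets :: "'x set \<Rightarrow> 'x set set \<Rightarrow> 'x set set" where
  "positive_sets X I = Pow X - I"

definition refinement :: "'i set \<Rightarrow> ('i \<Rightarrow> 'x set) \<Rightarrow> ('i \<Rightarrow> 'x set) \<Rightarrow> bool" where
  "refinement J B A \<longleftrightarrow> (\<forall>i\<in>J. B i \<subseteq> A i)"

text \<open>
  \<open>Restr \<beta> z =o \<alpha>\<close> says that \<open>z\<close> has ordertype \<open>\<alpha>\<close>. The intersections are taken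
  inside \<open>X\<close>, which only matters for the empty index set.
\<close>

definition regular2 :: "'x set \<Rightarrow> 'x set set \<Rightarrow> 'b rel \<Rightarrow> 'i rel \<Rightarrow> bool" where
  "regular2 X I \<alpha> \<beta> \<longleftrightarrow>
     (\<forall>A. (\<forall>i\<in>Field \<beta>. A i \<in> positive_sets X I) \<longrightarrow>
        (\<exists>B. refinement (Field \<beta>) B A \<and> (\<forall>i\<in>Field \<beta>. B i \<in> positive_sets X I) \<and>
           (\<forall>z. z \<subseteq> Field \<beta> \<and> Restr \<beta> z =o \<alpha> \<longrightarrow> X \<inter> (\<Inter>i\<in>z. B i) = {})))"

definition regular3 :: "'x set \<Rightarrow> 'x set set \<Rightarrow> 'b rel \<Rightarrow> 'c rel \<Rightarrow> 'i rel \<Rightarrow> bool" where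
  "regular3 X I \<alpha> \<beta> \<gamma> \<longleftrightarrow>
     (\<forall>A. (\<forall>i\<in>Field \<gamma>. A i \<in> positive_sets X I) \<longrightarrow>
        (\<exists>B. refinement (Field \<gamma>) B A \<and> (\<forall>i\<in>Field \<gamma>. B i \<in> positive_sets X I) \<and>
           (\<forall>x. x \<subseteq> Field \<gamma> \<and> Restr \<gamma> x =o \<beta> \<longrightarrow> |X \<inter> (\<Inter>i\<in>x. B i)| \<le>o \<alpha>)))"

lemma cofinal_Field:
  assumes "Cinfinite r"
  shows "cofinal (Field r) r"
  unfolding cofinal_def
  using assms infinite_Card_order_limit[of r] by (auto simp: cinfinite_def Field_def)

lemma cf_spec:
  assumes "Cinfinite r"
  shows "\<exists>K. K \<subseteq> Field r \<and> cofinal K r \<and> cf r = |K| \<and>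
      (\<forall>L. L \<subseteq> Field r \<and> cofinal L r \<longrightarrow> |K| \<le>o |L| )"
proof -
  let ?R = "{ |K| | K. K \<subseteq> Field r \<and> cofinal K r}"
  have "?R \<noteq> {}" using cofinal_Field[OF assms] by blast
  moreover have "\<forall>c\<in>?R. Card_order c" using card_of_Card_order by blast
  ultimately obtain c where "c \<in> ?R" "\<forall>c'\<in>?R. c \<le>o c'"
    using exists_minim_Card_order[of ?R] by blast
  then have "\<exists>c K. K \<subseteq> Field r \<and> cofinal K r \<and> c = |K| \<and>
      (\<forall>L. L \<subseteq> Field r \<and> cofinal L r \<longrightarrow> |K| \<le>o |L| )" by blast
  then show ?thesis unfolding cf_def by (rule someI_ex)
qed

lemma Field_ordsuc: "Field (ordsuc r) = insert None (Some ` Field r)"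
  by (auto simp: ordsuc_def Field_def image_iff)

lemma Well_order_ordsuc:
  assumes "Well_order r"
  shows "Well_order (ordsuc r)"
proof -
  have rf: "Refl r" and tr: "trans r" and an: "antisym r" and to: "Total r" and wf: "wf (r - Id)"
    using assms unfolding order_on_defs by auto
  have "Refl (ordsuc r)"
    using rf unfolding refl_on_def Field_ordsuc by (auto simp: ordsuc_def Field_def)
  moreover have "trans (ordsuc r)"
    unfolding ordsuc_def by (rule transI) (auto simp: Field_def dest: transD[OF tr])
  moreover have "antisym (ordsuc r)"
    using an unfolding antisym_def by (auto simp: ordsuc_def)
  moreover have "Total (ordsuc r)"
    using to unfolding total_on_def Field_ordsuc by (auto simp: ordsuc_def)
  moreover have "wf (ordsuc r - Id)"
  proof (rule wfUNIVI)
    fix P x assume H: "\<forall>x. (\<forall>y. (y, x) \<in> ordsuc r - Id \<longrightarrow> P y) \<longrightarrow> P x"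
    have S: "P (Some a)" for a
    proof (induction a rule: wf_induct_rule[OF wf])
      case (1 a)
      have "P y" if "(y, Some a) \<in> ordsuc r - Id" for y
        using that 1 by (auto simp: ordsuc_def)
      then show ?case using H by blast
    qed
    have "P y" if "(y, None) \<in> ordsuc r - Id" for y
      using that S by (cases y) auto
    then have "P None" using H by blast
    with S show "P x" by (cases x) auto
  qed
  moreover have "ordsuc r \<subseteq> Field (ordsuc r) \<times> Field (ordsuc r)"
    by (auto simp: Field_def)
  ultimately show ?thesis unfolding order_on_defs by auto
qed

end

theory Submission
  imports Defs
begin

text \<open>
  Think of forcing with the positive sets. Below a dense set of conditions one of two things happens.
  Either \<open>\<kappa>\<close> acquires a cofinal sequence, represented in the generic ultrapower, whose length is less
  than \<open>\<mu>\<close> and has a cofinality different from that of \<open>\<mu>\<close>; then \<open>\<kappa>\<^sup>+\<close> many eventually different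
  functions from \<open>\<kappa>\<close> to \<open>\<kappa>\<close>, evaluated along the sequence, yield a matrix with \<open>\<mu>\<close> colours whose
  \<open>\<kappa>\<^sup>+\<close> many columns are pairwise different almost everywhere, and hence a disjoint refinement of any
  \<open>\<kappa>\<close> many such conditions. Or \<open>\<kappa>\<close> acquires a cofinal sequence of length \<open>cf \<mu>\<close>; then ranking \<open>i\<close> by
  the first term that can exceed \<open>i\<close> gives a refinement in which intersecting sets have strictly
  increasing ranks below \<open>cf \<mu>\<close>. Part (i) is read off from the ranks. If each point lies in fewer than
  \<open>cf \<mu>\<close> many sets, the indices of these sets replace the second kind of sequence, and the refinement
  can be made disjoint: this gives (ii), and (iii) because \<open>\<mu>\<^sup>\<beta> = \<mu>\<close> implies \<open>|\<beta>| < cf \<mu>\<close> and leaves, for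
  each \<open>i\<close>, only \<open>\<mu>\<close> many points that lie in \<open>\<beta>\<close> many sets with indices below \<open>i\<close>.
\<close>

section \<open>Well-orders and cardinals\<close>

text \<open>Counting is the obstacle. Giving \<rho> sets distinct columns may cost \<rho>
  exceptional columns, so a matrix needs more than \<rho> of them. The injections \<open>e x\<close>
  of the predecessors of \<open>x\<close> into \<mu> yield \<kappa> columns, enough for \<mu> sets
  only; \<kappa> sets need \<open>\<kappa>'\<close> many columns, still with \<mu> colours. A value
  \<open>f \<alpha> (z c x)\<close> is coded faithfully by \<open>e x\<close> only if it is below
  \<open>x\<close>. This holds almost everywhere because \<open>z c\<close> represents an ordinal
  below \<kappa>. The condition on cofinalities puts the codes at cofinally many places of the
  sequence below one bound in \<mu>, which leaves fewer than \<mu> conflicts. The dichotomy arises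
  by splitting the predecessors of \<open>x\<close> into an increasing union of cf \<mu> many sets
  \<open>below k x\<close> of size less than \<mu>. If one of these is bounded in \<kappa> on no
  positive subset of some condition, its shortest unbounded initial segment is the sequence of
  length less than \<mu>; should it fail to be \<open>uncofinal\<close>, a subsequence indexed by cf
  \<mu> supplies the ranks. Otherwise the bounds of these sets are themselves cofinal in
  \<kappa>.\<close>

lemma wo_underS_or:
  assumes "Well_order r" "a \<in> Field r" "b \<in> Field r"
  shows "(a, b) \<in> r \<or> b \<in> underS r a"
  using assms unfolding well_order_on_def linear_order_on_def partial_order_on_def preorder_on_def
    total_on_def refl_on_def underS_def by (cases "a = b") auto

lemma wo_refl: "Well_order r \<Longrightarrow> a \<in> Field r \<Longrightarrow> (a, a) \<in> r"
  unfolding order_on_defs refl_on_def by auto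

lemma wo_trans: "Well_order r \<Longrightarrow> (a, b) \<in> r \<Longrightarrow> (b, c) \<in> r \<Longrightarrow> (a, c) \<in> r"
  unfolding order_on_defs trans_def by blast

lemma wo_antisym: "Well_order r \<Longrightarrow> (a, b) \<in> r \<Longrightarrow> (b, a) \<in> r \<Longrightarrow> a = b"
  unfolding order_on_defs antisym_def by blast

lemma wo_less_le_trans: "Well_order r \<Longrightarrow> a \<in> underS r b \<Longrightarrow> (b, c) \<in> r \<Longrightarrow> a \<in> underS r c"
  unfolding underS_def using wo_trans wo_antisym by (metis (mono_tags, lifting) mem_Collect_eq)

lemma wo_le_less_trans: "Well_order r \<Longrightarrow> (a, b) \<in> r \<Longrightarrow> b \<in> underS r c \<Longrightarrow> a \<in> underS r c"
  unfolding underS_def using wo_trans wo_antisym by (metis (mono_tags, lifting) mem_Collect_eq)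

lemma wo_not_le: "Well_order r \<Longrightarrow> b \<in> underS r a \<Longrightarrow> (a, b) \<notin> r"
  unfolding underS_def using wo_antisym by (metis (mono_tags, lifting) mem_Collect_eq)

lemma underS_le: "a \<in> underS r b \<Longrightarrow> (a, b) \<in> r"
  unfolding underS_def by auto

lemma in_underS_Field: "a \<in> underS r b \<Longrightarrow> a \<in> Field r"
  unfolding underS_def Field_def by auto

lemma underS_in_Field: "a \<in> underS r b \<Longrightarrow> b \<in> Field r"
  unfolding underS_def Field_def by auto

lemma wo_least:
  assumes "Well_order r" "S \<subseteq> Field r" "S \<noteq> {}"
  obtains m where "m \<in> S" "\<And>s. s \<in> S \<Longrightarrow> (m, s) \<in> r"
proof -
  have "wf (r - Id)" using assms(1) unfolding well_order_on_def by auto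
  then obtain m where m: "m \<in> S" "\<And>y. (y, m) \<in> r - Id \<Longrightarrow> y \<notin> S"
    using assms(3) wfE_min by (metis ex_in_conv)
  have "(m, s) \<in> r" if "s \<in> S" for s
    using wo_underS_or[OF assms(1), of m s] m that assms(2) unfolding underS_def by auto
  with m(1) show thesis by (rule that)
qed

lemma card_wo: "Card_order r \<Longrightarrow> Well_order r"
  unfolding card_order_on_def by auto

lemma not_card_le_iff: "Card_order r \<Longrightarrow> \<not> |A| \<le>o r \<longleftrightarrow> r <o |A|"
  using not_ordLeq_iff_ordLess[OF card_wo card_of_Well_order, of r A] by blast

lemma not_card_less_iff: "Card_order r \<Longrightarrow> \<not> |A| <o r \<longleftrightarrow> r \<le>o |A|"
  using not_ordLess_iff_ordLeq[OF card_wo card_of_Well_order, of r A] by blast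

lemma card_le_UN:
  assumes "Cinfinite r" "|J| \<le>o r" "\<And>j. j \<in> J \<Longrightarrow> |A j| \<le>o r"
  shows "|\<Union>j\<in>J. A j| \<le>o r"
  using assms card_of_UNION_ordLeq_infinite_Field[of r J A] unfolding cinfinite_def by blast

lemma card_le_subset: "A \<subseteq> B \<Longrightarrow> |B| \<le>o r \<Longrightarrow> |A| \<le>o r"
  using card_of_mono1 ordLeq_transitive by blast

lemma card_le_image: "|A| \<le>o r \<Longrightarrow> |f ` A| \<le>o r"
  using card_of_image ordLeq_transitive by blast

lemma card_less_subset: "A \<subseteq> B \<Longrightarrow> |B| <o r \<Longrightarrow> |A| <o r"
  using card_of_mono1 ordLeq_ordLess_trans by blast

lemma card_le_inj: "inj_on f A \<Longrightarrow> f ` A \<subseteq> B \<Longrightarrow> |A| \<le>o |B|"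
  using card_of_ordLeq by blast

lemma card_le_Un:
  assumes "Cinfinite r" "|A| \<le>o r" "|B| \<le>o r"
  shows "|A \<union> B| \<le>o r"
  using assms card_of_Un_ordLeq_infinite_Field[of r A B] unfolding cinfinite_def by blast

lemma card_le_singleton: "Cinfinite r \<Longrightarrow> |{a}| \<le>o r"
  by (metis Card_order_singl_ordLeq cinfinite_def finite.emptyI)

lemma card_under_less:
  assumes "Cinfinite r" "a \<in> Field r"
  shows "|{b. (b, a) \<in> r}| <o r"
proof -
  have co: "Card_order r" and inf: "infinite (Field r)" using assms(1) by (auto simp: cinfinite_def)
  have wo: "Well_order r" by (rule card_wo[OF co])
  obtain c where c: "c \<in> Field r" "a \<noteq> c" "(a, c) \<in> r"
    using infinite_Card_order_limit[OF co inf assms(2)] by blast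
  then have "a \<in> underS r c" unfolding underS_def by auto
  then have "{b. (b, a) \<in> r} \<subseteq> underS r c" using wo_le_less_trans[OF wo] by blast
  then show ?thesis using card_less_subset card_of_underS[OF co c(1)] by blast
qed

lemma card_less_Times_aux:
  assumes "|A| \<le>o |B|" "infinite B" "|B| <o r"
  shows "|A \<times> B| <o r" "|B \<times> A| <o r"
proof -
  have "infinite (Field |B| )" using assms(2) by (simp add: Field_card_of)
  then have "|A \<times> B| \<le>o |B|" "|B \<times> A| \<le>o |B|"
    using card_of_Times_ordLeq_infinite_Field[of "|B|"] assms(1) card_of_Card_order[of B]
      card_of_refl[of B, THEN ordIso_imp_ordLeq] by blast+
  then show "|A \<times> B| <o r" "|B \<times> A| <o r" using assms(3) ordLeq_ordLess_trans by blast+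
qed

lemma card_less_Times:
  assumes "Cinfinite r" "|A| <o r" "|B| <o r"
  shows "|A \<times> B| <o r"
proof (cases "finite A \<and> finite B")
  case True
  then have "finite (Field |A \<times> B| )" by (simp add: Field_card_of)
  moreover have "infinite (Field r)" "Well_order r" using assms(1) card_wo by (auto simp: cinfinite_def)
  ultimately show ?thesis using finite_ordLess_infinite[OF card_of_Well_order] by blast
next
  case False
  consider "|A| \<le>o |B|" | "|B| \<le>o |A|" using ordLeq_total[OF card_of_Well_order card_of_Well_order] by blast
  then show ?thesis
  proof cases
    case 1
    then have "infinite B" using False card_of_ordLeq_finite by blast
    then show ?thesis using card_less_Times_aux(1)[OF 1] assms(3) by blast
  next
    case 2
    then have "infinite A" using False card_of_ordLeq_finite by blast
    then show ?thesis using card_less_Times_aux(2)[OF 2] assms(2) by blast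
  qed
qed

text \<open>Greedy recursion along \<open>r\<close>: the earlier values on \<open>D a\<close> cannot
  exhaust the larger set \<open>T a\<close>. The recursive choices of representatives, functions and
  colours below are instances.\<close>

lemma wo_avoid:
  fixes T :: "'a \<Rightarrow> 'b set"
  assumes "Well_order r"
    and D: "\<And>a. a \<in> Field r \<Longrightarrow> D a \<subseteq> underS r a"
    and less: "\<And>a. a \<in> Field r \<Longrightarrow> |D a| <o |T a|"
  shows "\<exists>f. \<forall>a\<in>Field r. f a \<in> T a \<and> f a \<notin> f ` D a"
proof -
  have wf: "wf (r - Id)" using assms(1) unfolding well_order_on_def by auto
  define P where "P f a y \<longleftrightarrow> (a \<in> Field r \<longrightarrow> y \<in> T a \<and> y \<notin> f ` D a)" for f a y
  have "\<exists>f. \<forall>a. P f a (f a)"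
  proof (rule dependent_wf_choice[OF wf])
    fix f g :: "'a \<Rightarrow> 'b" and x y assume eq: "\<And>z. (z, x) \<in> r - Id \<Longrightarrow> f z = g z"
    have "f ` D x = g ` D x" if "x \<in> Field r"
      using D[OF that] eq by (intro image_cong) (auto simp: underS_def)
    then show "P f x y = P g x y" unfolding P_def by auto
  next
    fix x and f :: "'a \<Rightarrow> 'b"
    show "\<exists>y. P f x y"
    proof (cases "x \<in> Field r")
      case True
      have "|f ` D x| <o |T x|" using less[OF True] card_of_image ordLeq_ordLess_trans by blast
      then have "\<not> T x \<subseteq> f ` D x"
        using card_of_mono1 not_ordLess_ordLeq by blast
      then show ?thesis unfolding P_def by auto
    qed (auto simp: P_def)
  qed
  then show ?thesis unfolding P_def by blast
qed

lemma distinct_representatives: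
  assumes "\<And>i. i \<in> J \<Longrightarrow> |J| <o |T i|"
  obtains g where "\<And>i. i \<in> J \<Longrightarrow> g i \<in> T i" "inj_on g J"
proof -
  have "\<exists>g. \<forall>i\<in>Field |J|. g i \<in> T i \<and> g i \<notin> g ` underS |J| i"
  proof (rule wo_avoid[OF card_of_Well_order])
    fix i assume "i \<in> Field |J|"
    then have i: "i \<in> J" by (simp add: Field_card_of)
    have "underS |J| i \<subseteq> J" using in_underS_Field[of _ "|J|" i] by (auto simp: Field_card_of)
    then have "|underS |J| i| \<le>o |J|" by (rule card_of_mono1)
    then show "|underS |J| i| <o |T i|" using assms[OF i] ordLeq_ordLess_trans by blast
  qed auto
  then obtain g where g: "\<And>i. i \<in> J \<Longrightarrow> g i \<in> T i \<and> g i \<notin> g ` underS |J| i"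
    by (auto simp: Field_card_of)
  have "inj_on g J"
  proof (rule inj_onI, rule ccontr)
    fix i j assume ij: "i \<in> J" "j \<in> J" "g i = g j" "i \<noteq> j"
    then have "i \<in> underS |J| j \<or> j \<in> underS |J| i"
      using wo_underS_or[OF card_of_Well_order, of i J j] by (auto simp: Field_card_of underS_def)
    then have "g i \<in> g ` underS |J| j \<or> g j \<in> g ` underS |J| i" by (metis imageI)
    then show False using g[OF ij(1)] g[OF ij(2)] ij(3) by auto
  qed
  with g that show thesis by blast
qed

section \<open>Complete ideals on a successor cardinal\<close>

locale successor_ideal =
  fixes \<mu> :: "'a rel" and \<kappa> :: "'a set rel" and I :: "'a set set set"
  assumes mu: "Cinfinite \<mu>"
    and kappa: "\<kappa> = cardSuc \<mu>"
    and ideal: "ideal_on (Field \<kappa>) I"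
    and nonprincipal: "nonprincipal_ideal (Field \<kappa>) I"
    and complete: "complete_ideal \<kappa> I"
begin

abbreviation X where "X \<equiv> Field \<kappa>"

definition pos where "pos A \<longleftrightarrow> A \<subseteq> X \<and> A \<notin> I"

lemma pos_eq: "pos A \<longleftrightarrow> A \<in> positive_sets X I"
  unfolding pos_def positive_sets_def by auto

lemma mu_card: "Card_order \<mu>" and mu_inf: "infinite (Field \<mu>)" and mu_wo: "Well_order \<mu>"
  using mu card_wo by (auto simp: cinfinite_def)

lemma kappa_card: "Card_order \<kappa>" unfolding kappa by (rule cardSuc_Card_order[OF mu_card])

lemma kappa_wo: "Well_order \<kappa>" by (rule card_wo[OF kappa_card])

lemma kappa_Cinf: "Cinfinite \<kappa>" unfolding kappa by (rule Cinfinite_cardSuc[OF mu])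

lemma less_kappa_iff: "|A| <o \<kappa> \<longleftrightarrow> |A| \<le>o \<mu>"
  unfolding kappa by (rule cardSuc_ordLeq_ordLess[OF mu_card card_of_Card_order])

lemma mu_le_kappa: "\<mu> \<le>o \<kappa>" unfolding kappa by (rule cardSuc_ordLeq[OF mu_card])

lemma X_big: "\<not> |X| \<le>o \<mu>"
  using less_kappa_iff[of X] card_of_Field_ordIso[OF kappa_card] not_ordLess_ordIso by blast

lemma Field_mu_le: "|Field \<mu>| \<le>o \<mu>"
  using card_of_Field_ordIso[OF mu_card] ordIso_imp_ordLeq by blast

lemma small_underS: "x \<in> X \<Longrightarrow> |underS \<kappa> x| \<le>o \<mu>"
  using card_of_underS[OF kappa_card] less_kappa_iff by blast

lemma small_under: "x \<in> X \<Longrightarrow> |{y. (y, x) \<in> \<kappa>}| \<le>o \<mu>"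
  using card_under_less[OF kappa_Cinf] less_kappa_iff by blast

lemma null_subset: "B \<in> I \<Longrightarrow> A \<subseteq> B \<Longrightarrow> A \<in> I"
  using ideal unfolding ideal_on_def by blast

lemma null_UN:
  assumes "|J| \<le>o \<mu>" "\<And>j. j \<in> J \<Longrightarrow> N j \<in> I"
  shows "(\<Union>j\<in>J. N j) \<in> I"
proof -
  have "|N ` J| <o \<kappa>" using card_le_image[OF assms(1)] less_kappa_iff by blast
  moreover have "N ` J \<subseteq> I" using assms(2) by auto
  ultimately show ?thesis using complete unfolding complete_ideal_def by blast
qed

lemma null_Un: "A \<in> I \<Longrightarrow> B \<in> I \<Longrightarrow> A \<union> B \<in> I"
  using ideal unfolding ideal_on_def by blast

lemma null_small:
  assumes "A \<subseteq> X" "|A| \<le>o \<mu>"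
  shows "A \<in> I"
proof -
  have "(\<Union>a\<in>A. {a}) \<in> I"
    using nonprincipal assms(1) unfolding nonprincipal_ideal_def by (intro null_UN[OF assms(2)]) auto
  then show ?thesis by simp
qed

lemma null_under: "x \<in> X \<Longrightarrow> {y. (y, x) \<in> \<kappa>} \<in> I"
  by (rule null_small[OF _ small_under]) (auto simp: Field_def)

lemma null_bounded: "x \<in> X \<Longrightarrow> (\<And>y. y \<in> A \<Longrightarrow> (y, x) \<in> \<kappa>) \<Longrightarrow> A \<in> I"
  using null_subset[OF null_under] by blast

lemma pos_sub: "pos A \<Longrightarrow> A \<subseteq> X" unfolding pos_def by auto

lemma pos_mono: "pos A \<Longrightarrow> A \<subseteq> B \<Longrightarrow> B \<subseteq> X \<Longrightarrow> pos B"
  unfolding pos_def using null_subset by blast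

lemma pos_diff:
  assumes "pos A" "N \<in> I" "A - N \<subseteq> B" "B \<subseteq> A"
  shows "pos B"
proof -
  have "A \<subseteq> B \<union> N" using assms(3) by auto
  then have "B \<notin> I" using null_Un[OF _ assms(2)] null_subset assms(1) unfolding pos_def by blast
  then show ?thesis using assms unfolding pos_def by auto
qed

lemma pos_split:
  assumes "pos A" "|P| \<le>o \<mu>" "\<And>x. x \<in> A \<Longrightarrow> \<exists>p\<in>P. R x p"
  obtains p where "p \<in> P" "pos {x\<in>A. R x p}"
proof -
  have "\<exists>p\<in>P. {x\<in>A. R x p} \<notin> I"
  proof (rule ccontr)
    assume "\<not> ?thesis"
    then have "(\<Union>p\<in>P. {x\<in>A. R x p}) \<in> I" using null_UN[OF assms(2), of "\<lambda>p. {x\<in>A. R x p}"] by blast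
    moreover have "A \<subseteq> (\<Union>p\<in>P. {x\<in>A. R x p})" using assms(3) by auto
    ultimately show False using assms(1) null_subset unfolding pos_def by blast
  qed
  then show thesis using that assms(1) unfolding pos_def by blast
qed

lemma pos_nonempty: "pos A \<Longrightarrow> A \<noteq> {}"
  using ideal unfolding pos_def ideal_on_def by blast

lemma small_bounded:
  assumes "A \<subseteq> X" "|A| \<le>o \<mu>"
  obtains b where "b \<in> X" "\<And>a. a \<in> A \<Longrightarrow> a \<in> underS \<kappa> b"
proof -
  have "|\<Union>a\<in>A. {y. (y, a) \<in> \<kappa>}| \<le>o \<mu>"
    using assms small_under by (intro card_le_UN[OF mu]) auto
  then have "\<not> X \<subseteq> (\<Union>a\<in>A. {y. (y, a) \<in> \<kappa>})" using card_le_subset X_big by blast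
  then obtain b where b: "b \<in> X" "\<And>a. a \<in> A \<Longrightarrow> (b, a) \<notin> \<kappa>" by blast
  then have "a \<in> underS \<kappa> b" if "a \<in> A" for a
    using wo_underS_or[OF kappa_wo b(1), of a] assms(1) that by blast
  with b(1) that show thesis by blast
qed

text \<open>The source of an Ulam matrix. The code is defined for all \<open>y\<close>, with a
  default in \<open>Field \<mu>\<close>, so that it serves as a colour without asking whether
  \<open>y\<close> is below \<open>x\<close>.\<close>

lemma injection_exists: "\<exists>e. \<forall>x\<in>X. inj_on (e x) (underS \<kappa> x) \<and> (\<forall>y. e x y \<in> Field \<mu>)"
proof -
  have "\<exists>g. inj_on g (underS \<kappa> x) \<and> (\<forall>y. g y \<in> Field \<mu>)" if "x \<in> X" for x
  proof -
    have "|underS \<kappa> x| \<le>o |Field \<mu>|"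
      using small_underS[OF that] card_of_Field_ordIso[OF mu_card] ordIso_symmetric ordLeq_ordIso_trans by blast
    then obtain g where g: "inj_on g (underS \<kappa> x)" "g ` underS \<kappa> x \<subseteq> Field \<mu>"
      using card_of_ordLeq[of "underS \<kappa> x" "Field \<mu>"] by blast
    obtain m where m: "m \<in> Field \<mu>" using mu_inf by fastforce
    have "inj_on (\<lambda>y. if y \<in> underS \<kappa> x then g y else m) (underS \<kappa> x)" using g(1) by (simp add: inj_on_def)
    moreover have "\<forall>y. (if y \<in> underS \<kappa> x then g y else m) \<in> Field \<mu>" using g(2) m by auto
    ultimately show ?thesis by blast
  qed
  then show ?thesis by (intro bchoice) blast
qed

definition e where "e = (SOME e. \<forall>x\<in>X. inj_on (e x) (underS \<kappa> x) \<and> (\<forall>y. e x y \<in> Field \<mu>))"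

lemma e_inj: "x \<in> X \<Longrightarrow> inj_on (e x) (underS \<kappa> x)" and e_Field: "x \<in> X \<Longrightarrow> e x y \<in> Field \<mu>"
  using someI_ex[OF injection_exists] unfolding e_def[symmetric] by auto

subsection \<open>Almost disjoint refinements\<close>

text \<open>
  A column \<open>\<alpha>\<close> of the matrix \<open>E\<close> splits \<open>A i\<close> into at most \<open>\<mu>\<close> pieces. Each \<open>A i\<close> keeps the piece
  with the least value that is positive in more than \<open>\<rho>\<close> columns; using the least value makes
  pieces with different values almost disjoint, as soon as the columns avoid the exceptional ones.
\<close>

lemma matrix_refinement:
  assumes rho: "Cinfinite \<rho>" "\<mu> \<le>o \<rho>" and J: "|J| \<le>o \<rho>"
    and Phi: "|\<Phi>| \<le>o \<mu>" and Lam: "\<not> |\<Lambda>| \<le>o \<rho>"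
    and E: "\<And>x \<alpha>. x \<in> X \<Longrightarrow> \<alpha> \<in> \<Lambda> \<Longrightarrow> E x \<alpha> \<in> \<Phi>"
    and diff: "\<And>i \<alpha> \<beta>. i \<in> J \<Longrightarrow> \<alpha> \<in> \<Lambda> \<Longrightarrow> \<beta> \<in> \<Lambda> \<Longrightarrow> \<alpha> \<noteq> \<beta> \<Longrightarrow> {x\<in>A i. E x \<alpha> = E x \<beta>} \<in> I"
    and A: "\<And>i. i \<in> J \<Longrightarrow> pos (A i)"
  obtains B where "\<And>i. i \<in> J \<Longrightarrow> pos (B i) \<and> B i \<subseteq> A i"
    "\<And>i j. i \<in> J \<Longrightarrow> j \<in> J \<Longrightarrow> i \<noteq> j \<Longrightarrow> B i \<inter> B j \<in> I"
proof -
  have co: "Card_order \<rho>" using rho by blast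
  have Phi_rho: "|\<Phi>| \<le>o \<rho>" using Phi rho(2) ordLeq_transitive by blast
  define T where "T i \<phi> = {\<alpha>\<in>\<Lambda>. pos {x\<in>A i. E x \<alpha> = \<phi>}}" for i \<phi>
  define S where "S i = {\<phi>\<in>\<Phi>. \<not> |T i \<phi>| \<le>o \<rho>}" for i
  have Sne: "S i \<noteq> {}" if "i \<in> J" for i
  proof
    assume "S i = {}"
    then have "|\<Union>\<phi>\<in>\<Phi>. T i \<phi>| \<le>o \<rho>" unfolding S_def by (intro card_le_UN[OF rho(1) Phi_rho]) blast
    moreover have "\<Lambda> \<subseteq> (\<Union>\<phi>\<in>\<Phi>. T i \<phi>)"
    proof
      fix \<alpha> assume al: "\<alpha> \<in> \<Lambda>"
      have "\<exists>p\<in>\<Phi>. E x \<alpha> = p" if "x \<in> A i" for x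
        using E[OF _ al] pos_sub[OF A[OF \<open>i \<in> J\<close>]] that by blast
      then obtain p where "p \<in> \<Phi>" "pos {x\<in>A i. E x \<alpha> = p}"
        by (rule pos_split[OF A[OF \<open>i \<in> J\<close>] Phi])
      then show "\<alpha> \<in> (\<Union>\<phi>\<in>\<Phi>. T i \<phi>)" using al unfolding T_def by auto
    qed
    ultimately show False using Lam card_le_subset by blast
  qed
  have "\<forall>i\<in>J. \<exists>\<phi>. \<phi> \<in> S i \<and> (\<forall>\<psi>\<in>S i. (\<phi>, \<psi>) \<in> |\<Phi>| )"
  proof
    fix i assume i: "i \<in> J"
    have "S i \<subseteq> Field |\<Phi>|" unfolding S_def by (auto simp: Field_card_of)
    then show "\<exists>\<phi>. \<phi> \<in> S i \<and> (\<forall>\<psi>\<in>S i. (\<phi>, \<psi>) \<in> |\<Phi>| )"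
      using wo_least[OF card_of_Well_order _ Sne[OF i]] by metis
  qed
  then obtain \<pi> where pi: "\<And>i. i \<in> J \<Longrightarrow> \<pi> i \<in> S i" "\<And>i \<psi>. i \<in> J \<Longrightarrow> \<psi> \<in> S i \<Longrightarrow> (\<pi> i, \<psi>) \<in> |\<Phi>|"
    by (metis (no_types, lifting) bchoice)
  \<comment> \<open>A column is bad if for some \<open>j\<close> it makes a piece of
    \<open>A j\<close> with a value outside \<open>S j\<close> positive. For each such value at most
    \<rho> columns do so, hence at most \<rho> columns are bad.\<close>
  define bad where "bad = (\<Union>j\<in>J. \<Union>\<phi>\<in>\<Phi> - S j. T j \<phi>)"
  have "|\<Phi> - S j| \<le>o \<rho>" for j using Phi_rho card_le_subset[of "\<Phi> - S j" \<Phi>] by blast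
  then have bad: "|bad| \<le>o \<rho>" unfolding bad_def
    by (intro card_le_UN[OF rho(1) J] card_le_UN[OF rho(1)]) (auto simp: S_def)
  have "|J| <o |T i (\<pi> i) - bad|" if "i \<in> J" for i
  proof -
    have "\<not> |T i (\<pi> i)| \<le>o \<rho>" using pi(1)[OF that] unfolding S_def by auto
    moreover have "T i (\<pi> i) \<subseteq> (T i (\<pi> i) - bad) \<union> bad" by auto
    ultimately have "\<not> |T i (\<pi> i) - bad| \<le>o \<rho>"
      using card_le_Un[OF rho(1) _ bad] card_le_subset by blast
    then show ?thesis using not_card_le_iff[OF co] J ordLeq_ordLess_trans by blast
  qed
  then obtain g where g: "\<And>i. i \<in> J \<Longrightarrow> g i \<in> T i (\<pi> i) - bad" "inj_on g J"
    by (rule distinct_representatives[of J "\<lambda>i. T i (\<pi> i) - bad"]) blast+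
  define B where "B i = {x\<in>A i. E x (g i) = \<pi> i}" for i
  have B: "pos (B i) \<and> B i \<subseteq> A i" if "i \<in> J" for i
    using g(1)[OF that] unfolding B_def T_def by auto
  have less: "B i \<inter> B j \<in> I" if i: "i \<in> J" and j: "j \<in> J" and n: "\<pi> i \<notin> S j" for i j
  proof -
    have "g i \<notin> T j (\<pi> i)" "g i \<in> \<Lambda>" using g(1)[OF i] n j pi(1)[OF i] unfolding bad_def T_def S_def by auto
    then have "{x\<in>A j. E x (g i) = \<pi> i} \<in> I" using pos_sub[OF A[OF j]] unfolding T_def pos_def by blast
    then show ?thesis by (rule null_subset) (auto simp: B_def)
  qed
  have "B i \<inter> B j \<in> I" if ij: "i \<in> J" "j \<in> J" "i \<noteq> j" for i j
  proof (cases "\<pi> i = \<pi> j")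
    case True
    have "g i \<noteq> g j" using g(2) ij unfolding inj_on_def by auto
    moreover have "g i \<in> \<Lambda>" "g j \<in> \<Lambda>" using g(1) ij unfolding T_def by auto
    ultimately have "{x\<in>A i. E x (g i) = E x (g j)} \<in> I" using diff ij by blast
    then show ?thesis by (rule null_subset) (use True in \<open>auto simp: B_def\<close>)
  next
    case False
    then have "\<pi> i \<notin> S j \<or> \<pi> j \<notin> S i"
      using pi(2)[OF ij(1), of "\<pi> j"] pi(2)[OF ij(2), of "\<pi> i"]
        wo_antisym[OF card_of_Well_order[of \<Phi>], of "\<pi> i" "\<pi> j"] by blast
    then show ?thesis using less[OF ij(1,2)] less[OF ij(2,1)] by (auto simp: Int_commute)
  qed
  with B that show thesis by blast
qed

text \<open>Here the matrix is \<open>e\<close> itself: two columns can agree at \<open>x\<close>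
  only if one of their indices is not below \<open>x\<close>, so on a null set. Almost disjoint sets
  become disjoint by removing at most \<mu> null intersections from each.\<close>

lemma small_disjoint_refinement:
  assumes J: "|J| \<le>o \<mu>" and A: "\<And>i. i \<in> J \<Longrightarrow> pos (A i)"
  obtains B where "\<And>i. i \<in> J \<Longrightarrow> pos (B i) \<and> B i \<subseteq> A i"
    "\<And>i j. i \<in> J \<Longrightarrow> j \<in> J \<Longrightarrow> i \<noteq> j \<Longrightarrow> B i \<inter> B j = {}"
proof -
  obtain B where B: "\<And>i. i \<in> J \<Longrightarrow> pos (B i) \<and> B i \<subseteq> A i"
    "\<And>i j. i \<in> J \<Longrightarrow> j \<in> J \<Longrightarrow> i \<noteq> j \<Longrightarrow> B i \<inter> B j \<in> I"
  proof (rule matrix_refinement[OF mu _ J Field_mu_le X_big, of e A])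
    show "\<mu> \<le>o \<mu>" using mu_wo ordLeq_reflexive by blast
    show "{x\<in>A i. e x \<alpha> = e x \<beta>} \<in> I" if "i \<in> J" "\<alpha> \<in> X" "\<beta> \<in> X" "\<alpha> \<noteq> \<beta>" for i \<alpha> \<beta>
    proof (rule null_subset[OF null_Un[OF null_under[OF that(2)] null_under[OF that(3)]]], rule subsetI)
      fix x assume x: "x \<in> {x\<in>A i. e x \<alpha> = e x \<beta>}"
      then have xX: "x \<in> X" using A[OF that(1)] pos_sub by blast
      then have "\<not> (\<alpha> \<in> underS \<kappa> x \<and> \<beta> \<in> underS \<kappa> x)" using e_inj[OF xX] x that(4) unfolding inj_on_def by auto
      then show "x \<in> {y. (y, \<alpha>) \<in> \<kappa>} \<union> {y. (y, \<beta>) \<in> \<kappa>}"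
        using wo_underS_or[OF kappa_wo xX] that by blast
    qed
  qed (use A e_Field in blast)+
  define B' where "B' i = B i - (\<Union>j\<in>J - {i}. B i \<inter> B j)" for i
  have "pos (B' i)" if "i \<in> J" for i
  proof (rule pos_diff)
    show "pos (B i)" using B(1)[OF that] by auto
    show "(\<Union>j\<in>J - {i}. B i \<inter> B j) \<in> I"
      using B(2)[OF that] card_le_subset[OF _ J, of "J - {i}"] by (intro null_UN) auto
  qed (auto simp: B'_def)
  then show thesis using that[of B'] B(1) unfolding B'_def by blast
qed

text \<open>Although there are \<kappa> many sets, it is enough to remove from each its null
  intersections with earlier ones, and these are at most \<mu> many.\<close>

lemma disjointify:
  assumes B: "\<And>i. i \<in> X \<Longrightarrow> pos (B i)"
  obtains B' where "\<And>i. i \<in> X \<Longrightarrow> pos (B' i) \<and> B' i \<subseteq> B i"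
    "\<And>i j. i \<in> X \<Longrightarrow> j \<in> X \<Longrightarrow> i \<noteq> j \<Longrightarrow> B i \<inter> B j \<in> I \<Longrightarrow> B' i \<inter> B' j = {}"
proof -
  define S where "S i = {j \<in> underS \<kappa> i. B i \<inter> B j \<in> I}" for i
  define B' where "B' i = B i - (\<Union>j\<in>S i. B i \<inter> B j)" for i
  have 1: "pos (B' i)" if "i \<in> X" for i
  proof (rule pos_diff)
    show "pos (B i)" using B[OF that] .
    show "(\<Union>j\<in>S i. B i \<inter> B j) \<in> I"
      using card_le_subset[OF _ small_underS[OF that], of "S i"] by (intro null_UN) (auto simp: S_def)
  qed (auto simp: B'_def)
  have less: "B' i \<inter> B' j = {}" if "j \<in> underS \<kappa> i" "B i \<inter> B j \<in> I" for i j
    using that unfolding B'_def S_def by blast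
  have "B' i \<inter> B' j = {}" if "i \<in> X" "j \<in> X" "i \<noteq> j" "B i \<inter> B j \<in> I" for i j
    using less[of j i] less[of i j] wo_underS_or[OF kappa_wo that(1,2)] that(3,4)
    by (auto simp: underS_def Int_commute)
  then show thesis using that[of B'] 1 unfolding B'_def by blast
qed

text \<open>\<open>R\<close> is a graph of conflicts. Degrees at most \<mu> give connected
  components of size at most \<mu>, and edges do not leave a component, so only the sets within one
  component have to be made disjoint.\<close>

lemma sparse_refinement:
  assumes R: "R \<subseteq> J \<times> J" "sym R" and deg: "\<And>i. i \<in> J \<Longrightarrow> |R `` {i}| \<le>o \<mu>"
    and A: "\<And>i. i \<in> J \<Longrightarrow> pos (A i)"
  obtains B where "\<And>i. i \<in> J \<Longrightarrow> pos (B i) \<and> B i \<subseteq> A i"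
    "\<And>i j. (i, j) \<in> R \<Longrightarrow> i \<noteq> j \<Longrightarrow> B i \<inter> B j = {}"
proof -
  define K where "K i = R\<^sup>* `` {i}" for i
  have KJ: "K i \<subseteq> J" if "i \<in> J" for i
    using that R(1) unfolding K_def by (auto elim: rtranclE)
  have lev: "|(R ^^ n) `` {i}| \<le>o \<mu>" if "i \<in> J" for i n
  proof (induction n)
    case 0 then show ?case using card_le_singleton[OF mu] by simp
  next
    case (Suc n)
    have "(R ^^ n) `` {i} \<subseteq> J" using KJ[OF that] relpow_imp_rtrancl[of "(i, _)" n R] unfolding K_def by blast
    then have "|\<Union>j\<in>(R ^^ n) `` {i}. R `` {j}| \<le>o \<mu>" using deg by (intro card_le_UN[OF mu Suc]) auto
    then show ?case by (rule card_le_subset[rotated]) auto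
  qed
  have K: "|K i| \<le>o \<mu>" if "i \<in> J" for i
  proof -
    have "|UNIV::nat set| \<le>o \<mu>"
      using mu_inf infinite_iff_card_of_nat[of "Field \<mu>"] Field_mu_le ordLeq_transitive by blast
    then have "|\<Union>n. (R ^^ n) `` {i}| \<le>o \<mu>" using lev[OF that] by (intro card_le_UN[OF mu]) auto
    then show ?thesis unfolding K_def
      by (rule card_le_subset[rotated]) (auto dest: rtrancl_imp_relpow)
  qed
  have ex: "\<exists>B. (\<forall>j\<in>C. pos (B j) \<and> B j \<subseteq> A j) \<and> (\<forall>j\<in>C. \<forall>k\<in>C. j \<noteq> k \<longrightarrow> B j \<inter> B k = {})"
    if "C \<in> K ` J" for C
  proof -
    have "|C| \<le>o \<mu>" "\<And>j. j \<in> C \<Longrightarrow> pos (A j)" using that K KJ A by blast+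
    then show ?thesis
    proof (rule small_disjoint_refinement[of C A])
      fix B assume "\<And>j. j \<in> C \<Longrightarrow> pos (B j) \<and> B j \<subseteq> A j"
        "\<And>j k. j \<in> C \<Longrightarrow> k \<in> C \<Longrightarrow> j \<noteq> k \<Longrightarrow> B j \<inter> B k = {}"
      then show ?thesis by (intro exI[of _ B]) simp
    qed
  qed
  \<comment> \<open>The refinement is chosen per component and not per index, so that neighbours use
    the same one.\<close>
  obtain B where "\<forall>C\<in>K ` J. (\<forall>j\<in>C. pos (B C j) \<and> B C j \<subseteq> A j) \<and>
      (\<forall>j\<in>C. \<forall>k\<in>C. j \<noteq> k \<longrightarrow> B C j \<inter> B C k = {})"
    using bchoice[OF ballI[OF ex]] by (rule exE)
  then have B: "\<And>i j. i \<in> J \<Longrightarrow> j \<in> K i \<Longrightarrow> pos (B (K i) j) \<and> B (K i) j \<subseteq> A j"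
     "\<And>i j k. i \<in> J \<Longrightarrow> j \<in> K i \<Longrightarrow> k \<in> K i \<Longrightarrow> j \<noteq> k \<Longrightarrow> B (K i) j \<inter> B (K i) k = {}"
    by simp_all
  have self: "i \<in> K i" for i unfolding K_def by auto
  have eq: "K i = K j" if "(i, j) \<in> R" for i j
  proof -
    have "(j, i) \<in> R" using that R(2) unfolding sym_def by blast
    then show ?thesis using that unfolding K_def by (auto intro: converse_rtrancl_into_rtrancl)
  qed
  show thesis
  proof (rule that[of "\<lambda>i. B (K i) i"])
    show "pos (B (K i) i) \<and> B (K i) i \<subseteq> A i" if "i \<in> J" for i using B(1)[OF that self] .
    show "B (K i) i \<inter> B (K j) j = {}" if "(i, j) \<in> R" "i \<noteq> j" for i j
      using B(2)[of i i j] eq[OF that(1)] self[of i] self[of j] that R(1) by auto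
  qed
qed

text \<open>
  If the positive sets of some kind are dense below every \<open>A i\<close>, choosing for each \<open>i\<close> the least
  possible kind makes sets of different kinds almost disjoint; so it suffices to refine the
  families of sets of one kind.
\<close>

lemma kindwise_refinement:
  fixes P :: "'k \<Rightarrow> 'a set set \<Rightarrow> bool" and A :: "'i \<Rightarrow> 'a set set" and Q :: "'i \<Rightarrow> 'i \<Rightarrow> 'c \<Rightarrow> 'c \<Rightarrow> bool"
  assumes hered: "\<And>k q q'. P k q \<Longrightarrow> pos q' \<Longrightarrow> q' \<subseteq> q \<Longrightarrow> P k q'"
    and dense: "\<And>i. i \<in> J \<Longrightarrow> \<exists>k q. pos q \<and> q \<subseteq> A i \<and> P k q"
    and solve: "\<And>k K q. K \<subseteq> J \<Longrightarrow> (\<And>i. i \<in> K \<Longrightarrow> pos (q i) \<and> q i \<subseteq> A i \<and> P k (q i)) \<Longrightarrow>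
      \<exists>B c. (\<forall>i\<in>K. pos (B i) \<and> B i \<subseteq> q i \<and> c i \<in> L) \<and> (\<forall>i\<in>K. \<forall>j\<in>K. i \<noteq> j \<longrightarrow> B i \<inter> B j \<in> I \<or> Q i j (c i) (c j))"
  shows "\<exists>B c. (\<forall>i\<in>J. pos (B i) \<and> B i \<subseteq> A i \<and> c i \<in> L) \<and>
      (\<forall>i\<in>J. \<forall>j\<in>J. i \<noteq> j \<longrightarrow> B i \<inter> B j \<in> I \<or> Q i j (c i) (c j))"
proof -
  let ?r = "|UNIV :: 'k set|"
  define S where "S i = {k. \<exists>q. pos q \<and> q \<subseteq> A i \<and> P k q}" for i
  have "\<exists>k. k \<in> S i \<and> (\<forall>l\<in>S i. (k, l) \<in> ?r)" if "i \<in> J" for i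
  proof -
    have "S i \<noteq> {}" using dense[OF that] unfolding S_def by blast
    then show ?thesis using wo_least[of ?r "S i"] by (metis Field_card_of card_of_Well_order subset_UNIV)
  qed
  then obtain \<pi> where pi: "\<And>i. i \<in> J \<Longrightarrow> \<pi> i \<in> S i" "\<And>i l. i \<in> J \<Longrightarrow> l \<in> S i \<Longrightarrow> (\<pi> i, l) \<in> ?r"
    by metis
  then obtain q where q: "\<And>i. i \<in> J \<Longrightarrow> pos (q i) \<and> q i \<subseteq> A i \<and> P (\<pi> i) (q i)"
    unfolding S_def mem_Collect_eq by metis
  \<comment> \<open>A positive intersection would be a set of kind \<open>\<pi> i\<close> below
    \<open>A j\<close>.\<close>
  have null1: "q i \<inter> q j \<in> I" if "i \<in> J" "j \<in> J" "\<pi> i \<notin> S j" for i j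
  proof (rule ccontr)
    assume "q i \<inter> q j \<notin> I"
    then have "pos (q i \<inter> q j)" using q[OF that(1)] pos_sub unfolding pos_def by blast
    then have "\<pi> i \<in> S j" using hered[of "\<pi> i" "q i"] q[OF that(1)] q[OF that(2)] unfolding S_def by blast
    then show False using that(3) by simp
  qed
  have null: "q i \<inter> q j \<in> I" if "i \<in> J" "j \<in> J" "\<pi> i \<noteq> \<pi> j" for i j
  proof -
    have "\<pi> i \<notin> S j \<or> \<pi> j \<notin> S i"
      using pi(2)[OF that(1), of "\<pi> j"] pi(2)[OF that(2), of "\<pi> i"] that(3)
        wo_antisym[OF card_of_Well_order[of "UNIV :: 'k set"], of "\<pi> i" "\<pi> j"] by blast
    then show ?thesis using null1 that by (metis Int_commute)
  qed
  define K where "K k = {i\<in>J. \<pi> i = k}" for k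
  have "\<forall>k. \<exists>Bc. (\<forall>i\<in>K k. pos (fst Bc i) \<and> fst Bc i \<subseteq> q i \<and> snd Bc i \<in> L) \<and>
     (\<forall>i\<in>K k. \<forall>j\<in>K k. i \<noteq> j \<longrightarrow> fst Bc i \<inter> fst Bc j \<in> I \<or> Q i j (snd Bc i) (snd Bc j))"
  proof
    fix k
    have "K k \<subseteq> J" "\<And>i. i \<in> K k \<Longrightarrow> pos (q i) \<and> q i \<subseteq> A i \<and> P k (q i)"
      using q unfolding K_def by auto
    from solve[OF this] show "\<exists>Bc. (\<forall>i\<in>K k. pos (fst Bc i) \<and> fst Bc i \<subseteq> q i \<and> snd Bc i \<in> L) \<and>
     (\<forall>i\<in>K k. \<forall>j\<in>K k. i \<noteq> j \<longrightarrow> fst Bc i \<inter> fst Bc j \<in> I \<or> Q i j (snd Bc i) (snd Bc j))" by simp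
  qed
  from choice[OF this] obtain Bc where
    Bc: "\<And>k i. i \<in> K k \<Longrightarrow> pos (fst (Bc k) i) \<and> fst (Bc k) i \<subseteq> q i \<and> snd (Bc k) i \<in> L"
     "\<And>k i j. i \<in> K k \<Longrightarrow> j \<in> K k \<Longrightarrow> i \<noteq> j \<Longrightarrow>
        fst (Bc k) i \<inter> fst (Bc k) j \<in> I \<or> Q i j (snd (Bc k) i) (snd (Bc k) j)" by metis
  let ?B = "\<lambda>i. fst (Bc (\<pi> i)) i" and ?c = "\<lambda>i. snd (Bc (\<pi> i)) i"
  have "pos (?B i) \<and> ?B i \<subseteq> A i \<and> ?c i \<in> L" if "i \<in> J" for i
    using Bc(1)[of i "\<pi> i"] q[OF that] that unfolding K_def by blast
  moreover have "?B i \<inter> ?B j \<in> I \<or> Q i j (?c i) (?c j)" if "i \<in> J" "j \<in> J" "i \<noteq> j" for i j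
  proof (cases "\<pi> i = \<pi> j")
    case True
    then show ?thesis using Bc(2)[of i "\<pi> i" j] that unfolding K_def by auto
  next
    case False
    have "?B i \<subseteq> q i" "?B j \<subseteq> q j"
      using Bc(1)[of i "\<pi> i"] Bc(1)[of j "\<pi> j"] that unfolding K_def by auto
    then have "?B i \<inter> ?B j \<subseteq> q i \<inter> q j" by auto
    then show ?thesis using null_subset[OF null[OF that(1,2) False]] by simp
  qed
  ultimately show ?thesis by (intro exI[of _ ?B] exI[of _ ?c]) blast
qed

end

section \<open>Cofinal sequences in the generic ultrapower\<close>

context successor_ideal
begin

section \<open>Eventually different functions from \<kappa> to \<kappa>, indexed by the successor of
  \<kappa>\<close>

abbreviation \<kappa>' where "\<kappa>' \<equiv> cardSuc \<kappa>"

lemma kappa'_wo: "Well_order \<kappa>'"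
  by (rule card_wo[OF cardSuc_Card_order[OF kappa_card]])

lemma kappa'_underS: "\<alpha> \<in> Field \<kappa>' \<Longrightarrow> |underS \<kappa>' \<alpha>| \<le>o \<kappa>"
  using card_of_underS[OF cardSuc_Card_order[OF kappa_card]]
    cardSuc_ordLeq_ordLess[OF kappa_card card_of_Card_order] by blast

lemma kappa'_big: "\<not> |Field \<kappa>'| \<le>o \<kappa>"
  using cardSuc_ordLeq_ordLess[OF kappa_card card_of_Card_order[of "Field \<kappa>'"]]
    card_of_Field_ordIso[OF cardSuc_Card_order[OF kappa_card]] not_ordLess_ordIso by blast

lemma le_kappa_injection:
  assumes "|A| \<le>o \<kappa>"
  obtains g where "inj_on g A" "g ` A \<subseteq> X"
proof -
  have "|A| \<le>o |X|"
    using assms card_of_Field_ordIso[OF kappa_card] ordIso_symmetric ordLeq_ordIso_trans by blast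
  then show thesis using card_of_ordLeq[of A X] that by blast
qed

text \<open>For each \<open>z\<close> separately, the values \<open>f \<alpha> z\<close> are chosen
  by recursion on \<alpha>. Only the \<beta> whose code \<open>g \<alpha> \<beta>\<close> is at most
  \<open>z\<close> have to be avoided, at most \<mu> many; every earlier \<beta> is among them once
  \<open>z\<close> is large enough.\<close>

lemma pairwise_eventually_different_family:
  obtains f g where "\<And>\<alpha> z. \<alpha> \<in> Field \<kappa>' \<Longrightarrow> f \<alpha> z \<in> X"
    "\<And>\<alpha> \<beta>. \<beta> \<in> underS \<kappa>' \<alpha> \<Longrightarrow> g \<alpha> \<beta> \<in> X"
    "\<And>\<alpha> \<beta> z. \<beta> \<in> underS \<kappa>' \<alpha> \<Longrightarrow> (g \<alpha> \<beta>, z) \<in> \<kappa> \<Longrightarrow> f \<alpha> z \<noteq> f \<beta> z"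
proof -
  have "\<exists>g. inj_on g (underS \<kappa>' \<alpha>) \<and> g ` underS \<kappa>' \<alpha> \<subseteq> X" if "\<alpha> \<in> Field \<kappa>'" for \<alpha>
    using le_kappa_injection[OF kappa'_underS[OF that]] by blast
  then obtain g where g: "\<And>\<alpha>. \<alpha> \<in> Field \<kappa>' \<Longrightarrow> inj_on (g \<alpha>) (underS \<kappa>' \<alpha>) \<and> g \<alpha> ` underS \<kappa>' \<alpha> \<subseteq> X"
    by metis
  have "\<exists>f. \<forall>\<alpha>\<in>Field \<kappa>'. f \<alpha> \<in> X \<and> f \<alpha> \<notin> f ` {\<beta>\<in>underS \<kappa>' \<alpha>. (g \<alpha> \<beta>, z) \<in> \<kappa>}" for z
  proof (rule wo_avoid[OF kappa'_wo])
    fix \<alpha> assume al: "\<alpha> \<in> Field \<kappa>'"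
    let ?D = "{\<beta>\<in>underS \<kappa>' \<alpha>. (g \<alpha> \<beta>, z) \<in> \<kappa>}"
    have "|?D| \<le>o \<mu>"
    proof (cases "z \<in> X")
      case True
      have "inj_on (g \<alpha>) ?D" by (rule inj_on_subset[of _ "underS \<kappa>' \<alpha>"]) (use g[OF al] in auto)
      then have "|?D| \<le>o |{y. (y, z) \<in> \<kappa>}|" by (rule card_le_inj) auto
      then show ?thesis using small_under[OF True] ordLeq_transitive by blast
    next
      case False
      then have "?D = {}" by (auto simp: Field_def)
      then show ?thesis using card_le_singleton[OF mu, of undefined] card_le_subset[of "{}"] by (metis empty_subsetI)
    qed
    then show "|?D| <o |X|"
      using X_big not_card_le_iff[OF mu_card] ordLeq_ordLess_trans by blast
  qed auto
  then have "\<forall>z. \<exists>f. \<forall>\<alpha>\<in>Field \<kappa>'. f \<alpha> \<in> X \<and> f \<alpha> \<notin> f ` {\<beta>\<in>underS \<kappa>' \<alpha>. (g \<alpha> \<beta>, z) \<in> \<kappa>}" by simp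
  from choice[OF this] obtain f where
    f: "\<And>z \<alpha>. \<alpha> \<in> Field \<kappa>' \<Longrightarrow> f z \<alpha> \<in> X \<and> f z \<alpha> \<notin> f z ` {\<beta>\<in>underS \<kappa>' \<alpha>. (g \<alpha> \<beta>, z) \<in> \<kappa>}"
    by blast
  show thesis
  proof (rule that[of "\<lambda>\<alpha> z. f z \<alpha>" g])
    show "f z \<alpha> \<in> X" if "\<alpha> \<in> Field \<kappa>'" for \<alpha> z using f[OF that] by auto
    show "g \<alpha> \<beta> \<in> X" if "\<beta> \<in> underS \<kappa>' \<alpha>" for \<alpha> \<beta> using g[OF underS_in_Field[OF that]] that by auto
    show "f z \<alpha> \<noteq> f z \<beta>" if "\<beta> \<in> underS \<kappa>' \<alpha>" "(g \<alpha> \<beta>, z) \<in> \<kappa>" for \<alpha> \<beta> z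
      using f[OF underS_in_Field[OF that(1)], of z] that by auto
  qed
qed

text \<open>Thresholds for pairs become thresholds for single indices: below a fixed \<alpha>,
  \<open>f \<beta> z\<close> determines \<beta> among those whose threshold \<open>z\<close> has
  passed. The predecessors of \<alpha> are listed in \<kappa> by \<open>p\<close>. The threshold of
  \<beta> bounds those of its pairs with earlier members of the list, at most \<mu> many, and each
  pair is handled by its later member.\<close>

lemma eventually_different_family:
  obtains f h where "\<And>\<alpha> z. \<alpha> \<in> Field \<kappa>' \<Longrightarrow> f \<alpha> z \<in> X"
    "\<And>\<alpha> \<beta>. \<beta> \<in> underS \<kappa>' \<alpha> \<Longrightarrow> h \<alpha> \<beta> \<in> X"
    "\<And>\<alpha> \<beta> \<gamma> z. \<beta> \<in> underS \<kappa>' \<alpha> \<Longrightarrow> \<gamma> \<in> underS \<kappa>' \<alpha> \<Longrightarrow> \<beta> \<noteq> \<gamma> \<Longrightarrow> (h \<alpha> \<beta>, z) \<in> \<kappa> \<Longrightarrow> (h \<alpha> \<gamma>, z) \<in> \<kappa> \<Longrightarrow> f \<beta> z \<noteq> f \<gamma> z"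
proof -
  obtain f g where f: "\<And>\<alpha> z. \<alpha> \<in> Field \<kappa>' \<Longrightarrow> f \<alpha> z \<in> X"
    and g: "\<And>\<alpha> \<beta>. \<beta> \<in> underS \<kappa>' \<alpha> \<Longrightarrow> g \<alpha> \<beta> \<in> X"
    and fg: "\<And>\<alpha> \<beta> z. \<beta> \<in> underS \<kappa>' \<alpha> \<Longrightarrow> (g \<alpha> \<beta>, z) \<in> \<kappa> \<Longrightarrow> f \<alpha> z \<noteq> f \<beta> z"
    using pairwise_eventually_different_family by blast
  have "\<exists>h. \<forall>\<beta>\<in>underS \<kappa>' \<alpha>. h \<beta> \<in> X \<and> (\<forall>\<gamma>\<in>underS \<kappa>' \<alpha>. \<beta> \<noteq> \<gamma> \<longrightarrow> (\<forall>z.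
     (h \<beta>, z) \<in> \<kappa> \<and> (h \<gamma>, z) \<in> \<kappa> \<longrightarrow> f \<beta> z \<noteq> f \<gamma> z))" if al: "\<alpha> \<in> Field \<kappa>'" for \<alpha>
  proof -
    let ?U = "underS \<kappa>' \<alpha>"
    obtain p where p: "inj_on p ?U" "p ` ?U \<subseteq> X" using le_kappa_injection[OF kappa'_underS[OF al]] by blast
    define D where "D \<beta> = {\<gamma>\<in>?U. (p \<gamma>, p \<beta>) \<in> \<kappa>}" for \<beta>
    have "\<exists>b\<in>X. \<forall>\<gamma>\<in>D \<beta>. (\<gamma> \<in> underS \<kappa>' \<beta> \<longrightarrow> (g \<beta> \<gamma>, b) \<in> \<kappa>) \<and> (\<beta> \<in> underS \<kappa>' \<gamma> \<longrightarrow> (g \<gamma> \<beta>, b) \<in> \<kappa>)"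
      if be: "\<beta> \<in> ?U" for \<beta>
    proof -
      have "inj_on p (D \<beta>)" by (rule inj_on_subset[OF p(1)]) (auto simp: D_def)
      then have "|D \<beta>| \<le>o |{y. (y, p \<beta>) \<in> \<kappa>}|" by (rule card_le_inj) (auto simp: D_def)
      then have D: "|D \<beta>| \<le>o \<mu>" using small_under[of "p \<beta>"] p(2) be ordLeq_transitive by blast
      let ?S = "(g \<beta> ` (D \<beta> \<inter> underS \<kappa>' \<beta>)) \<union> ((\<lambda>\<gamma>. g \<gamma> \<beta>) ` (D \<beta> \<inter> {\<gamma>. \<beta> \<in> underS \<kappa>' \<gamma>}))"
      have "|?S| \<le>o \<mu>" by (intro card_le_Un[OF mu] card_le_image card_le_subset[OF _ D]) auto
      moreover have "?S \<subseteq> X" using g by auto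
      ultimately obtain b where b: "b \<in> X" "\<And>a. a \<in> ?S \<Longrightarrow> a \<in> underS \<kappa> b" using small_bounded[of ?S] by blast
      have "(g \<beta> \<gamma>, b) \<in> \<kappa>" if "\<gamma> \<in> D \<beta>" "\<gamma> \<in> underS \<kappa>' \<beta>" for \<gamma>
        using that by (intro underS_le[OF b(2)]) auto
      moreover have "(g \<gamma> \<beta>, b) \<in> \<kappa>" if "\<gamma> \<in> D \<beta>" "\<beta> \<in> underS \<kappa>' \<gamma>" for \<gamma>
        using that by (intro underS_le[OF b(2)]) auto
      ultimately show ?thesis using b(1) by blast
    qed
    then obtain h where h: "\<And>\<beta>. \<beta> \<in> ?U \<Longrightarrow> h \<beta> \<in> X"
      "\<And>\<beta> \<gamma>. \<beta> \<in> ?U \<Longrightarrow> \<gamma> \<in> D \<beta> \<Longrightarrow> (\<gamma> \<in> underS \<kappa>' \<beta> \<longrightarrow> (g \<beta> \<gamma>, h \<beta>) \<in> \<kappa>) \<and> (\<beta> \<in> underS \<kappa>' \<gamma> \<longrightarrow> (g \<gamma> \<beta>, h \<beta>) \<in> \<kappa>)"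
      by metis
    have 1: "f \<beta> z \<noteq> f \<gamma> z" if "\<beta> \<in> ?U" "\<gamma> \<in> D \<beta>" "\<beta> \<noteq> \<gamma>" "(h \<beta>, z) \<in> \<kappa>" for \<beta> \<gamma> z
    proof -
      have "\<gamma> \<in> underS \<kappa>' \<beta> \<or> \<beta> \<in> underS \<kappa>' \<gamma>"
        using wo_underS_or[OF kappa'_wo, of \<beta> \<gamma>] that in_underS_Field[of _ \<kappa>' \<alpha>] unfolding D_def underS_def by auto
      then show ?thesis
        using fg[of \<gamma> \<beta> z] fg[of \<beta> \<gamma> z] h(2)[OF that(1,2)] wo_trans[OF kappa_wo _ that(4)] by metis
    qed
    have "f \<beta> z \<noteq> f \<gamma> z" if "\<beta> \<in> ?U" "\<gamma> \<in> ?U" "\<beta> \<noteq> \<gamma>" "(h \<beta>, z) \<in> \<kappa>" "(h \<gamma>, z) \<in> \<kappa>" for \<beta> \<gamma> z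
    proof -
      have "\<gamma> \<in> D \<beta> \<or> \<beta> \<in> D \<gamma>"
        using wo_underS_or[OF kappa_wo, of "p \<beta>" "p \<gamma>"] p(2) that(1,2) unfolding D_def underS_def by auto
      then show ?thesis using 1[of \<beta> \<gamma> z] 1[of \<gamma> \<beta> z] that by metis
    qed
    then show ?thesis using h(1) by blast
  qed
  then obtain h where "\<And>\<alpha>. \<alpha> \<in> Field \<kappa>' \<Longrightarrow> \<forall>\<beta>\<in>underS \<kappa>' \<alpha>. h \<alpha> \<beta> \<in> X \<and> (\<forall>\<gamma>\<in>underS \<kappa>' \<alpha>. \<beta> \<noteq> \<gamma> \<longrightarrow> (\<forall>z.
     (h \<alpha> \<beta>, z) \<in> \<kappa> \<and> (h \<alpha> \<gamma>, z) \<in> \<kappa> \<longrightarrow> f \<beta> z \<noteq> f \<gamma> z))" by metis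
  then have "\<And>\<alpha> \<beta>. \<beta> \<in> underS \<kappa>' \<alpha> \<Longrightarrow> h \<alpha> \<beta> \<in> X"
    "\<And>\<alpha> \<beta> \<gamma> z. \<beta> \<in> underS \<kappa>' \<alpha> \<Longrightarrow> \<gamma> \<in> underS \<kappa>' \<alpha> \<Longrightarrow> \<beta> \<noteq> \<gamma> \<Longrightarrow> (h \<alpha> \<beta>, z) \<in> \<kappa> \<Longrightarrow> (h \<alpha> \<gamma>, z) \<in> \<kappa> \<Longrightarrow> f \<beta> z \<noteq> f \<gamma> z"
    using underS_in_Field by metis+
  then show thesis using that[of f h] f by blast
qed

text \<open>In the generic ultrapower, \<open>g\<close> represents below \<open>q\<close> an ordinal
  less than \<kappa>: completeness makes these ordinals the ones represented by constant
  functions.\<close>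

definition loc_const where
  "loc_const g q \<longleftrightarrow> (\<forall>q'\<subseteq>q. pos q' \<longrightarrow> (\<exists>\<gamma>\<in>X. pos {x\<in>q'. g x = \<gamma>}))"

text \<open>
  The functions \<open>z c\<close> represent, below the condition \<open>q\<close>, a sequence of ordinals below \<open>\<kappa>\<close> in the
  generic ultrapower that is cofinal in \<open>\<kappa>\<close>.
\<close>

definition cofseq where
  "cofseq C z q \<longleftrightarrow> C \<subseteq> Field \<mu> \<and> |C| <o \<mu> \<and>
     (\<forall>x\<in>q. \<forall>c\<in>C. z c x \<in> X) \<and>
     (\<forall>x\<in>q. \<forall>c\<in>C. \<forall>d\<in>C. (c, d) \<in> \<mu> \<longrightarrow> (z c x, z d x) \<in> \<kappa>) \<and>
     (\<forall>c\<in>C. loc_const (z c) q) \<and>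
     (\<forall>\<gamma>\<in>X. {x\<in>q. \<forall>c\<in>C. (z c x, \<gamma>) \<in> \<kappa>} \<in> I)"

text \<open>This holds as soon as the cofinality of \<open>C\<close> differs from that of \<open>\<mu>\<close>.\<close>

definition uncofinal where
  "uncofinal C \<longleftrightarrow> (\<forall>s. (\<forall>c\<in>C. s c \<in> Field \<mu>) \<longrightarrow>
     (\<exists>\<xi>\<in>Field \<mu>. \<forall>c\<in>C. \<exists>d\<in>C. (c, d) \<in> \<mu> \<and> s d \<in> underS \<mu> \<xi>))"

lemma loc_const_mono: "loc_const g q \<Longrightarrow> q' \<subseteq> q \<Longrightarrow> loc_const g q'"
  unfolding loc_const_def by blast

lemma cofseq_mono:
  assumes "cofseq C z q" "q' \<subseteq> q"
  shows "cofseq C z q'"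
proof -
  have "{x\<in>q'. \<forall>c\<in>C. (z c x, \<gamma>) \<in> \<kappa>} \<in> I" if "\<gamma> \<in> X" for \<gamma>
    by (rule null_subset[of "{x\<in>q. \<forall>c\<in>C. (z c x, \<gamma>) \<in> \<kappa>}"]) (use assms that in \<open>auto simp: cofseq_def\<close>)
  then show ?thesis using assms loc_const_mono unfolding cofseq_def by blast
qed

text \<open>
  Colour \<open>\<alpha>\<close> at \<open>x\<close> by the bound \<open>\<xi>\<close> that is obtained for \<open>c \<mapsto> e x (f \<alpha> (z c x))\<close>. Only fewer than
  \<open>\<mu>\<close> many \<open>\<beta>\<close> below \<open>\<alpha>\<close> conflict with \<open>\<alpha>\<close>, because \<open>f \<beta> (z d x)\<close> determines \<open>\<beta>\<close> once \<open>z d x\<close> exceeds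
  \<open>h \<alpha> \<beta>\<close>; a second colour separates \<open>\<alpha>\<close> from these.
\<close>

lemma cofseq_refinement:
  assumes J: "|J| \<le>o \<kappa>" and seq: "\<forall>i\<in>J. pos (A i) \<and> cofseq C z (A i)"
    and un: "uncofinal C"
  shows "\<exists>B. (\<forall>i\<in>J. pos (B i) \<and> B i \<subseteq> A i) \<and> (\<forall>i\<in>J. \<forall>j\<in>J. i \<noteq> j \<longrightarrow> B i \<inter> B j \<in> I)"
proof (cases "J = {}")
  case True
  then show ?thesis by simp
next
  case False
  have A: "pos (A i) \<and> cofseq C z (A i)" if "i \<in> J" for i using seq that by blast
  from False have C: "|C| <o \<mu>" using A unfolding cofseq_def by blast
  obtain f h where f: "\<And>\<alpha> z. \<alpha> \<in> Field \<kappa>' \<Longrightarrow> f \<alpha> z \<in> X"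
    and h: "\<And>\<alpha> \<beta>. \<beta> \<in> underS \<kappa>' \<alpha> \<Longrightarrow> h \<alpha> \<beta> \<in> X"
    and fh: "\<And>\<alpha> \<beta> \<gamma> z. \<beta> \<in> underS \<kappa>' \<alpha> \<Longrightarrow> \<gamma> \<in> underS \<kappa>' \<alpha> \<Longrightarrow> \<beta> \<noteq> \<gamma> \<Longrightarrow> (h \<alpha> \<beta>, z) \<in> \<kappa> \<Longrightarrow> (h \<alpha> \<gamma>, z) \<in> \<kappa> \<Longrightarrow> f \<beta> z \<noteq> f \<gamma> z"
    using eventually_different_family by blast
  have "\<exists>\<xi>. x \<in> X \<longrightarrow> \<xi> \<in> Field \<mu> \<and> (\<forall>c\<in>C. \<exists>d\<in>C. (c, d) \<in> \<mu> \<and> e x (f \<alpha> (z d x)) \<in> underS \<mu> \<xi>)" for x \<alpha>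
    using un[unfolded uncofinal_def, rule_format, of "\<lambda>c. e x (f \<alpha> (z c x))"] e_Field by blast
  then obtain \<xi> where xi: "\<And>x \<alpha>. x \<in> X \<Longrightarrow> \<xi> x \<alpha> \<in> Field \<mu>"
    "\<And>x \<alpha> c. x \<in> X \<Longrightarrow> c \<in> C \<Longrightarrow> \<exists>d\<in>C. (c, d) \<in> \<mu> \<and> e x (f \<alpha> (z d x)) \<in> underS \<mu> (\<xi> x \<alpha>)"
    by metis
  \<comment> \<open>The conflicts that the first colour leaves. The conditions on thresholds and on
    values below \<open>x\<close> hold almost everywhere and make it possible to count the
    conflicts.\<close>
  define D where "D x \<alpha> = {\<beta>\<in>underS \<kappa>' \<alpha>. \<xi> x \<beta> = \<xi> x \<alpha> \<and> (\<exists>c\<in>C. (h \<alpha> \<beta>, z c x) \<in> \<kappa>) \<and> (\<forall>c\<in>C. f \<beta> (z c x) \<in> underS \<kappa> x)}" for x \<alpha>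
  define good where "good x \<longleftrightarrow> x \<in> X \<and> (\<forall>c\<in>C. z c x \<in> X) \<and> (\<forall>c\<in>C. \<forall>d\<in>C. (c, d) \<in> \<mu> \<longrightarrow> (z c x, z d x) \<in> \<kappa>)" for x
  have Dless: "|D x \<alpha>| <o \<mu>" if g: "good x" and al: "\<alpha> \<in> Field \<kappa>'" for x \<alpha>
  proof -
    have xX: "x \<in> X" using g unfolding good_def by auto
    have "\<exists>d. d \<in> C \<and> (h \<alpha> \<beta>, z d x) \<in> \<kappa> \<and> e x (f \<beta> (z d x)) \<in> underS \<mu> (\<xi> x \<alpha>)" if be: "\<beta> \<in> D x \<alpha>" for \<beta>
    proof -
      obtain c where c: "c \<in> C" "(h \<alpha> \<beta>, z c x) \<in> \<kappa>" using be unfolding D_def by auto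
      obtain d where d: "d \<in> C" "(c, d) \<in> \<mu>" "e x (f \<beta> (z d x)) \<in> underS \<mu> (\<xi> x \<beta>)" using xi(2)[OF xX c(1)] by blast
      have "(h \<alpha> \<beta>, z d x) \<in> \<kappa>" using wo_trans[OF kappa_wo c(2)] g c(1) d(1,2) unfolding good_def by blast
      moreover have "\<xi> x \<beta> = \<xi> x \<alpha>" using be unfolding D_def by auto
      ultimately show ?thesis using d by auto
    qed
    then obtain d where d: "\<And>\<beta>. \<beta> \<in> D x \<alpha> \<Longrightarrow> d \<beta> \<in> C \<and> (h \<alpha> \<beta>, z (d \<beta>) x) \<in> \<kappa> \<and> e x (f \<beta> (z (d \<beta>) x)) \<in> underS \<mu> (\<xi> x \<alpha>)"
      by metis
    \<comment> \<open>A conflict is coded by a place in \<open>C\<close> and a code below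
      \<open>\<xi> x \<alpha>\<close>: at the same place, beyond both thresholds, equal codes mean
      equal values below \<open>x\<close> and hence equal indices.\<close>
    have "inj_on (\<lambda>\<beta>. (d \<beta>, e x (f \<beta> (z (d \<beta>) x)))) (D x \<alpha>)"
    proof (rule inj_onI, rule ccontr)
      fix \<beta> \<gamma> assume a: "\<beta> \<in> D x \<alpha>" "\<gamma> \<in> D x \<alpha>" "(d \<beta>, e x (f \<beta> (z (d \<beta>) x))) = (d \<gamma>, e x (f \<gamma> (z (d \<gamma>) x)))" "\<beta> \<noteq> \<gamma>"
      have dC: "d \<beta> \<in> C" "d \<beta> = d \<gamma>" using d[OF a(1)] a(3) by auto
      have "f \<beta> (z (d \<beta>) x) \<in> underS \<kappa> x" "f \<gamma> (z (d \<beta>) x) \<in> underS \<kappa> x" using a(1,2) dC(1) unfolding D_def by auto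
      then have "f \<beta> (z (d \<beta>) x) = f \<gamma> (z (d \<beta>) x)" using e_inj[OF xX] a(3) dC(2) unfolding inj_on_def by auto
      moreover have "f \<beta> (z (d \<beta>) x) \<noteq> f \<gamma> (z (d \<beta>) x)"
      proof (rule fh)
        show "\<beta> \<in> underS \<kappa>' \<alpha>" "\<gamma> \<in> underS \<kappa>' \<alpha>" using a(1,2) unfolding D_def by auto
        show "(h \<alpha> \<beta>, z (d \<beta>) x) \<in> \<kappa>" "(h \<alpha> \<gamma>, z (d \<beta>) x) \<in> \<kappa>" using d[OF a(1)] d[OF a(2)] dC(2) by auto
      qed (rule a(4))
      ultimately show False by simp
    qed
    then have "|D x \<alpha>| \<le>o |C \<times> underS \<mu> (\<xi> x \<alpha>)|" by (rule card_le_inj) (use d in auto)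
    then show ?thesis
      using card_less_Times[OF mu C card_of_underS[OF mu_card xi(1)[OF xX]]] ordLeq_ordLess_trans by blast
  qed
  have "\<exists>\<epsilon>. \<forall>\<alpha>\<in>Field \<kappa>'. \<epsilon> \<alpha> \<in> Field \<mu> \<and> (good x \<longrightarrow> \<epsilon> \<alpha> \<notin> \<epsilon> ` D x \<alpha>)" for x
  proof (cases "good x")
    case True
    have "\<exists>\<epsilon>. \<forall>\<alpha>\<in>Field \<kappa>'. \<epsilon> \<alpha> \<in> Field \<mu> \<and> \<epsilon> \<alpha> \<notin> \<epsilon> ` D x \<alpha>"
    proof (rule wo_avoid[OF kappa'_wo])
      fix \<alpha> assume "\<alpha> \<in> Field \<kappa>'"
      then show "|D x \<alpha>| <o |Field \<mu>|"
        using Dless[OF True] card_of_Field_ordIso[OF mu_card] ordIso_symmetric ordLess_ordIso_trans by blast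
    qed (auto simp: D_def)
    then show ?thesis by blast
  next
    case F: False
    obtain m where "m \<in> Field \<mu>" using mu_inf by fastforce
    then show ?thesis using F by (intro exI[of _ "\<lambda>_. m"]) auto
  qed
  then obtain \<epsilon> where eps: "\<And>x \<alpha>. \<alpha> \<in> Field \<kappa>' \<Longrightarrow> \<epsilon> x \<alpha> \<in> Field \<mu>"
    "\<And>x \<alpha>. \<alpha> \<in> Field \<kappa>' \<Longrightarrow> good x \<Longrightarrow> \<epsilon> x \<alpha> \<notin> \<epsilon> x ` D x \<alpha>" by metis
  define E where "E x \<alpha> = (\<xi> x \<alpha>, \<epsilon> x \<alpha>)" for x \<alpha>
  have null: "{x\<in>A i. E x \<alpha> = E x \<beta>} \<in> I" if i: "i \<in> J" and be: "\<beta> \<in> underS \<kappa>' \<alpha>" for i \<alpha> \<beta>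
  proof -
    have al: "\<alpha> \<in> Field \<kappa>'" and beF: "\<beta> \<in> Field \<kappa>'" by (rule underS_in_Field[OF be], rule in_underS_Field[OF be])
    have AX: "A i \<subseteq> X" using A[OF i] pos_sub by blast
    have cs: "cofseq C z (A i)" using A[OF i] by blast
    let ?N1 = "{x\<in>A i. \<forall>c\<in>C. (z c x, h \<alpha> \<beta>) \<in> \<kappa>}"
    let ?N2 = "\<lambda>c. {x\<in>A i. (x, f \<beta> (z c x)) \<in> \<kappa>}"
    have 1: "?N1 \<in> I" using cs h[OF be] unfolding cofseq_def by blast
    \<comment> \<open>Were this set positive, \<open>z c\<close> would have a constant value
      \<gamma> on a positive part of it, and that part would be bounded by
      \<open>f \<beta> \<gamma>\<close>.\<close>
    have 2: "?N2 c \<in> I" if c: "c \<in> C" for c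
    proof (rule ccontr)
      assume "?N2 c \<notin> I"
      then have "pos (?N2 c)" using AX unfolding pos_def by auto
      moreover have "loc_const (z c) (A i)" using cs c unfolding cofseq_def by blast
      moreover have "?N2 c \<subseteq> A i" by blast
      ultimately obtain \<gamma> where "pos {x\<in>?N2 c. z c x = \<gamma>}" unfolding loc_const_def by blast
      moreover have "{x\<in>?N2 c. z c x = \<gamma>} \<in> I" by (rule null_bounded[OF f[OF beF, of \<gamma>]]) auto
      ultimately show False unfolding pos_def by blast
    qed
    have 3: "(\<Union>c\<in>C. ?N2 c) \<in> I" by (rule null_UN[OF ordLess_imp_ordLeq[OF C] 2])
    show ?thesis
    proof (rule null_subset[OF null_Un[OF 1 3]], rule subsetI, rule ccontr)
      fix x assume x: "x \<in> {x\<in>A i. E x \<alpha> = E x \<beta>}" and n: "x \<notin> ?N1 \<union> (\<Union>c\<in>C. ?N2 c)"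
      have xX: "x \<in> X" using x AX by auto
      have g: "good x" using cs x xX unfolding cofseq_def good_def by blast
      have "\<exists>c\<in>C. (h \<alpha> \<beta>, z c x) \<in> \<kappa>"
      proof -
        obtain c where c: "c \<in> C" "(z c x, h \<alpha> \<beta>) \<notin> \<kappa>" using n x by auto
        have "z c x \<in> X" using g c(1) unfolding good_def by blast
        from wo_underS_or[OF kappa_wo this h[OF be]] c(2) have "h \<alpha> \<beta> \<in> underS \<kappa> (z c x)" by simp
        then have "(h \<alpha> \<beta>, z c x) \<in> \<kappa>" by (rule underS_le)
        then show ?thesis using c by blast
      qed
      moreover have "f \<beta> (z c x) \<in> underS \<kappa> x" if "c \<in> C" for c
        using wo_underS_or[OF kappa_wo xX f[OF beF, of "z c x"]] n x that by blast
      ultimately have "\<beta> \<in> D x \<alpha>" using x be unfolding D_def E_def by auto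
      then show False using eps(2)[OF al g] x unfolding E_def by auto
    qed
  qed
  have Phi: "|Field \<mu> \<times> Field \<mu>| \<le>o \<mu>"
    using card_of_Times_ordLeq_infinite_Field[OF mu_inf Field_mu_le Field_mu_le mu_card] .
  show ?thesis
  proof (rule matrix_refinement[OF kappa_Cinf mu_le_kappa J Phi kappa'_big, of E A])
    show "E x \<alpha> \<in> Field \<mu> \<times> Field \<mu>" if "x \<in> X" "\<alpha> \<in> Field \<kappa>'" for x \<alpha>
      using xi(1)[OF that(1)] eps(1)[OF that(2)] unfolding E_def by auto
    show "{x\<in>A i. E x \<alpha> = E x \<beta>} \<in> I" if "i \<in> J" "\<alpha> \<in> Field \<kappa>'" "\<beta> \<in> Field \<kappa>'" "\<alpha> \<noteq> \<beta>" for i \<alpha> \<beta>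
    proof -
      have "\<alpha> \<in> underS \<kappa>' \<beta> \<or> \<beta> \<in> underS \<kappa>' \<alpha>"
        using wo_underS_or[OF kappa'_wo that(2,3)] that(4) unfolding underS_def by auto
      moreover have "{x\<in>A i. E x \<alpha> = E x \<beta>} = {x\<in>A i. E x \<beta> = E x \<alpha>}" by auto
      ultimately show ?thesis using null[OF that(1), of \<alpha> \<beta>] null[OF that(1), of \<beta> \<alpha>] by metis
    qed
    show "pos (A i)" if "i \<in> J" for i using A[OF that] by blast
    fix B assume "\<And>i. i \<in> J \<Longrightarrow> pos (B i) \<and> B i \<subseteq> A i"
      "\<And>i j. i \<in> J \<Longrightarrow> j \<in> J \<Longrightarrow> i \<noteq> j \<Longrightarrow> B i \<inter> B j \<in> I"
    then show ?thesis by (intro exI[of _ B]) simp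
  qed
qed

end

text \<open>A set with fewer than \<open>r\<close> elements has order type less than the initial
  ordinal \<open>r\<close>. The index set of its enumeration depends only on \<open>\<tau>\<close>,
  which can later be fixed on a positive set.\<close>

lemma increasing_enumeration:
  assumes r: "Card_order r" and s: "Well_order s" and a: "a \<subseteq> Field s" "|a| <o r"
  shows "\<exists>\<tau>\<in>Field r. \<exists>f. bij_betw f (underS r \<tau>) a \<and>
    (\<forall>c\<in>underS r \<tau>. \<forall>d\<in>underS r \<tau>. (c, d) \<in> r \<longrightarrow> (f c, f d) \<in> s)"
proof -
  let ?s = "Restr s a"
  have wr: "Well_order r" by (rule card_wo[OF r])
  have ws: "Well_order ?s" by (rule Well_order_Restr[OF s])
  have Fs: "Field ?s = a" by (rule Refl_Field_Restr2) (use s a(1) in \<open>auto simp: order_on_defs\<close>)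
  have "\<not> r \<le>o ?s"
  proof
    assume "r \<le>o ?s"
    then have "|Field r| \<le>o |a|" using card_of_mono2[of r ?s] Fs by simp
    then have "r \<le>o |a|" using card_of_Field_ordIso[OF r] ordIso_symmetric ordIso_ordLeq_trans by blast
    then show False using a(2) not_ordLess_ordLeq by blast
  qed
  then have "?s <o r" using not_ordLeq_iff_ordLess[OF ws wr] by blast
  then obtain \<tau> where t: "\<tau> \<in> Field r" "?s =o Restr r (underS r \<tau>)"
    using ordLess_iff_ordIso_Restr[OF wr ws] by blast
  let ?r = "Restr r (underS r \<tau>)"
  have Fr: "Field ?r = underS r \<tau>"
    by (rule Refl_Field_Restr2) (use wr in \<open>auto simp: order_on_defs in_underS_Field\<close>)
  from t(2) have "?r =o ?s" by (rule ordIso_symmetric)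
  then obtain f where f: "iso ?r ?s f" unfolding ordIso_def by blast
  have "bij_betw f (underS r \<tau>) a" using f unfolding iso_def Fr Fs by blast
  moreover have "embed ?r ?s f" using f unfolding iso_def by blast
  then have "compat ?r ?s f" by (rule embed_compat)
  then have "(f c, f d) \<in> s" if "c \<in> underS r \<tau>" "d \<in> underS r \<tau>" "(c, d) \<in> r" for c d
    using that unfolding compat_def by auto
  ultimately show ?thesis using t(1) by blast
qed

section \<open>Cofinal sequences extracted from small unbounded sets\<close>

context successor_ideal
begin

lemma null_empty: "{} \<in> I" using ideal unfolding ideal_on_def by blast

text \<open>
  Below \<open>q\<close>, the set of ordinals represented by \<open>a\<close> has no element strictly between \<open>\<gamma>\<close> and \<open>\<kappa>\<close>; it
  may well have elements above \<open>\<kappa>\<close>, since the ideal need not be normal.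
\<close>

definition bdd where
  "bdd a \<gamma> q \<longleftrightarrow> (\<forall>\<delta>. \<gamma> \<in> underS \<kappa> \<delta> \<longrightarrow> {x\<in>q. \<delta> \<in> a x} \<in> I)"

lemma bdd_mono: "bdd a \<gamma> q \<Longrightarrow> q' \<subseteq> q \<Longrightarrow> bdd a \<gamma> q'"
  unfolding bdd_def
proof (intro allI impI)
  fix \<delta> assume a: "\<forall>\<delta>. \<gamma> \<in> underS \<kappa> \<delta> \<longrightarrow> {x\<in>q. \<delta> \<in> a x} \<in> I" "q' \<subseteq> q" "\<gamma> \<in> underS \<kappa> \<delta>"
  show "{x\<in>q'. \<delta> \<in> a x} \<in> I" by (rule null_subset[of "{x\<in>q. \<delta> \<in> a x}"]) (use a in auto)
qed

text \<open>The order type of \<open>a x\<close> is fixed on a positive set; then the sequence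
  consists of the first \<open>m\<close> terms, with \<open>m\<close> least such that these are
  unbounded in \<kappa> below some positive set. The comparison of \<open>C\<close> with
  \<open>a x\<close> serves the case where \<open>a x\<close> is smaller than cf \<mu>.\<close>

lemma unbounded_cofseq:
  assumes q: "pos q" and "\<forall>x\<in>q. a x \<subseteq> X \<and> |a x| <o \<mu>"
    and "\<forall>q' \<gamma>. q' \<subseteq> q \<longrightarrow> pos q' \<longrightarrow> \<gamma> \<in> X \<longrightarrow> \<not> bdd a \<gamma> q'"
  shows "\<exists>C z q'. q' \<subseteq> q \<and> pos q' \<and> cofseq C z q' \<and> (\<exists>x\<in>q. |C| \<le>o |a x| )"
proof -
  have a: "a x \<subseteq> X \<and> |a x| <o \<mu>" if "x \<in> q" for x using assms(2) that by blast
  have unb: "\<not> bdd a \<gamma> q'" if "q' \<subseteq> q" "pos q'" "\<gamma> \<in> X" for q' \<gamma> using assms(3) that by simp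
  have "\<forall>x\<in>q. \<exists>\<tau>. \<tau> \<in> Field \<mu> \<and> (\<exists>f. bij_betw f (underS \<mu> \<tau>) (a x) \<and>
    (\<forall>c\<in>underS \<mu> \<tau>. \<forall>d\<in>underS \<mu> \<tau>. (c, d) \<in> \<mu> \<longrightarrow> (f c, f d) \<in> \<kappa>))"
  proof
    fix x assume "x \<in> q"
    then have "a x \<subseteq> X" "|a x| <o \<mu>" using a by auto
    from increasing_enumeration[OF mu_card kappa_wo this]
    show "\<exists>\<tau>. \<tau> \<in> Field \<mu> \<and> (\<exists>f. bij_betw f (underS \<mu> \<tau>) (a x) \<and>
      (\<forall>c\<in>underS \<mu> \<tau>. \<forall>d\<in>underS \<mu> \<tau>. (c, d) \<in> \<mu> \<longrightarrow> (f c, f d) \<in> \<kappa>))" by (simp only: Bex_def)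
  qed
  from bchoice[OF this] obtain t where t: "\<forall>x\<in>q. t x \<in> Field \<mu> \<and> (\<exists>f. bij_betw f (underS \<mu> (t x)) (a x) \<and>
    (\<forall>c\<in>underS \<mu> (t x). \<forall>d\<in>underS \<mu> (t x). (c, d) \<in> \<mu> \<longrightarrow> (f c, f d) \<in> \<kappa>))" by blast
  obtain \<tau> where tau: "\<tau> \<in> Field \<mu>" and q0: "pos {x\<in>q. t x = \<tau>}"
    by (rule pos_split[OF q Field_mu_le, of "\<lambda>x p. t x = p"]) (use t in blast)+
  define p where "p = {x\<in>q. t x = \<tau>}"
  have p: "pos p" "p \<subseteq> q" using q0 unfolding p_def by auto
  have "\<forall>x\<in>p. \<exists>f. bij_betw f (underS \<mu> \<tau>) (a x) \<and>
    (\<forall>c\<in>underS \<mu> \<tau>. \<forall>d\<in>underS \<mu> \<tau>. (c, d) \<in> \<mu> \<longrightarrow> (f c, f d) \<in> \<kappa>)"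
    using t unfolding p_def by auto
  from bchoice[OF this] obtain Z where
    Z: "\<And>x. x \<in> p \<Longrightarrow> bij_betw (Z x) (underS \<mu> \<tau>) (a x)"
      "\<And>x c d. x \<in> p \<Longrightarrow> c \<in> underS \<mu> \<tau> \<Longrightarrow> d \<in> underS \<mu> \<tau> \<Longrightarrow> (c, d) \<in> \<mu> \<Longrightarrow> (Z x c, Z x d) \<in> \<kappa>" by blast
  define z where "z c x = Z x c" for c x
  have zimg: "a x = (\<lambda>c. z c x) ` underS \<mu> \<tau>" if "x \<in> p" for x
    using Z(1)[OF that] unfolding bij_betw_def z_def by auto
  have zX: "z c x \<in> X" if "x \<in> p" "c \<in> underS \<mu> \<tau>" for c x
    using zimg[OF that(1)] a[of x] p(2) that by blast
  have zmono: "(z c x, z d x) \<in> \<kappa>" if "x \<in> p" "c \<in> underS \<mu> \<tau>" "d \<in> underS \<mu> \<tau>" "(c, d) \<in> \<mu>" for x c d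
    using Z(2)[OF that] unfolding z_def .
  define unbd where "unbd m r \<longleftrightarrow> (\<forall>\<gamma>\<in>X. {x\<in>r. \<forall>c\<in>underS \<mu> m. (z c x, \<gamma>) \<in> \<kappa>} \<in> I)" for m r
  define M where "M = {m. (m, \<tau>) \<in> \<mu> \<and> (\<exists>r\<subseteq>p. pos r \<and> unbd m r)}"
  have "unbd \<tau> p" unfolding unbd_def
  proof (intro ballI, rule ccontr)
    fix \<gamma> assume g: "\<gamma> \<in> X" and n: "{x\<in>p. \<forall>c\<in>underS \<mu> \<tau>. (z c x, \<gamma>) \<in> \<kappa>} \<notin> I" (is "?S \<notin> I")
    have "pos ?S" using n pos_sub[OF p(1)] unfolding pos_def by auto
    moreover have "bdd a \<gamma> ?S" unfolding bdd_def
    proof (intro allI impI)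
      fix \<delta> assume d: "\<gamma> \<in> underS \<kappa> \<delta>"
      have "\<delta> \<notin> a x" if x: "x \<in> ?S" for x
      proof
        assume "\<delta> \<in> a x"
        then obtain c where "c \<in> underS \<mu> \<tau>" "\<delta> = z c x" using zimg[of x] x by auto
        then have "(\<delta>, \<gamma>) \<in> \<kappa>" using x by auto
        then show False using wo_not_le[OF kappa_wo d] by simp
      qed
      then have "{x\<in>?S. \<delta> \<in> a x} = {}" by auto
      then show "{x\<in>?S. \<delta> \<in> a x} \<in> I" using null_empty by (simp only:)
    qed
    moreover have "?S \<subseteq> q" using p(2) by auto
    ultimately show False using unb g by blast
  qed
  then have "\<tau> \<in> M" unfolding M_def using p(1) wo_refl[OF mu_wo tau] by auto
  moreover have "M \<subseteq> Field \<mu>" unfolding M_def by (auto simp: Field_def)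
  ultimately obtain m where m: "m \<in> M" and least: "\<And>n. n \<in> M \<Longrightarrow> (m, n) \<in> \<mu>"
    using wo_least[OF mu_wo, of M] by blast
  obtain r where r: "r \<subseteq> p" "pos r" "unbd m r" and mt: "(m, \<tau>) \<in> \<mu>" using m unfolding M_def by blast
  let ?C = "underS \<mu> m"
  have C: "?C \<subseteq> underS \<mu> \<tau>" using wo_less_le_trans[OF mu_wo _ mt] by blast
  \<comment> \<open>Without a constant positive part, \<open>z c\<close> would exceed every \<delta>
    almost everywhere on \<open>r'\<close>. By leastness of \<open>m\<close> the terms before
    \<open>c\<close> are bounded on a positive subset, so the part of \<open>a\<close> below
    \<kappa> would be bounded there.\<close>
  have lc: "loc_const (z c) r" if c: "c \<in> ?C" for c
    unfolding loc_const_def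
  proof (intro allI impI, rule ccontr)
    fix r' assume r': "r' \<subseteq> r" "pos r'" and n: "\<not> (\<exists>\<gamma>\<in>X. pos {x\<in>r'. z c x = \<gamma>})"
    have r'X: "r' \<subseteq> X" by (rule pos_sub[OF r'(2)])
    have null: "{x\<in>r'. (z c x, \<delta>) \<in> \<kappa>} \<in> I" if d: "\<delta> \<in> X" for \<delta>
    proof -
      have "(\<Union>\<gamma>\<in>{y. (y, \<delta>) \<in> \<kappa>}. {x\<in>r'. z c x = \<gamma>}) \<in> I"
      proof (rule null_UN[OF small_under[OF d]])
        fix \<gamma> assume "\<gamma> \<in> {y. (y, \<delta>) \<in> \<kappa>}"
        then have "\<gamma> \<in> X" by (auto simp: Field_def)
        then show "{x\<in>r'. z c x = \<gamma>} \<in> I" using n r'X unfolding pos_def by blast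
      qed
      then show ?thesis by (rule null_subset) auto
    qed
    have "(c, \<tau>) \<in> \<mu>" using C c by (intro underS_le) auto
    moreover have "c \<notin> M" using least[of c] wo_not_le[OF mu_wo c] by auto
    ultimately have "\<not> unbd c r'" using r' r(1) unfolding M_def by blast
    then obtain \<gamma> where g: "\<gamma> \<in> X" "{x\<in>r'. \<forall>d\<in>underS \<mu> c. (z d x, \<gamma>) \<in> \<kappa>} \<notin> I" (is "?S \<notin> I")
      unfolding unbd_def by blast
    have "pos ?S" using g(2) r'X unfolding pos_def by auto
    moreover have "bdd a \<gamma> ?S" unfolding bdd_def
    proof (intro allI impI)
      fix \<delta> assume d: "\<gamma> \<in> underS \<kappa> \<delta>"
      have "{x\<in>?S. \<delta> \<in> a x} \<subseteq> {x\<in>r'. (z c x, \<delta>) \<in> \<kappa>}"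
      proof
        fix x assume x: "x \<in> {x\<in>?S. \<delta> \<in> a x}"
        then have xp: "x \<in> p" using r'(1) r(1) by auto
        obtain b where b: "b \<in> underS \<mu> \<tau>" "\<delta> = z b x" using x zimg[OF xp] by auto
        have "b \<notin> underS \<mu> c" using x b(2) wo_not_le[OF kappa_wo d] by auto
        then have "(c, b) \<in> \<mu>"
          using wo_underS_or[OF mu_wo in_underS_Field[OF c] in_underS_Field[OF b(1)]] by blast
        then have "(z c x, \<delta>) \<in> \<kappa>" using zmono[OF xp _ b(1)] C c b(2) by blast
        then show "x \<in> {x\<in>r'. (z c x, \<delta>) \<in> \<kappa>}" using x by auto
      qed
      then show "{x\<in>?S. \<delta> \<in> a x} \<in> I" by (rule null_subset[OF null[OF underS_in_Field[OF d]]])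
    qed
    moreover have "?S \<subseteq> q" using r'(1) r(1) p(2) by auto
    ultimately show False using unb g(1) by blast
  qed
  have mF: "m \<in> Field \<mu>" using mt by (auto simp: Field_def)
  have "cofseq ?C z r" unfolding cofseq_def
  proof (intro conjI ballI impI)
    show "?C \<subseteq> Field \<mu>" using in_underS_Field[of _ \<mu> m] by auto
    show "|?C| <o \<mu>" by (rule card_of_underS[OF mu_card mF])
    show "z c x \<in> X" if "x \<in> r" "c \<in> ?C" for x c using zX that r(1) C by blast
    show "(z c x, z d x) \<in> \<kappa>" if "x \<in> r" "c \<in> ?C" "d \<in> ?C" "(c, d) \<in> \<mu>" for x c d
      using zmono that r(1) C by blast
    show "loc_const (z c) r" if "c \<in> ?C" for c by (rule lc[OF that])
    show "{x\<in>r. \<forall>c\<in>?C. (z c x, \<gamma>) \<in> \<kappa>} \<in> I" if "\<gamma> \<in> X" for \<gamma> using r(3) that unfolding unbd_def by blast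
  qed
  moreover obtain x where x: "x \<in> r" using pos_nonempty[OF r(2)] by blast
  then have xp: "x \<in> p" using r(1) by blast
  have "|?C| \<le>o |a x|"
    by (rule card_le_inj[of "Z x"]) (use Z(1)[OF xp] C in \<open>auto simp: bij_betw_def intro: inj_on_subset\<close>)
  ultimately show ?thesis using r p(2) xp by (intro exI[of _ ?C] exI[of _ z] exI[of _ r]) blast
qed

subsection \<open>The cofinality of \<open>\<mu>\<close>\<close>

lemma cf_card: "Card_order (cf \<mu>)" and cf_cofinal: "cofinal (Field (cf \<mu>)) \<mu>"
  and cf_Field: "Field (cf \<mu>) \<subseteq> Field \<mu>" and cf_least: "L \<subseteq> Field \<mu> \<Longrightarrow> cofinal L \<mu> \<Longrightarrow> cf \<mu> \<le>o |L|"
  using cf_spec[OF mu] card_of_Card_order by (auto simp: Field_card_of)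

lemma cf_wo: "Well_order (cf \<mu>)" by (rule card_wo[OF cf_card])

lemma cf_le: "cf \<mu> \<le>o \<mu>"
  using cf_least[OF subset_refl cofinal_Field[OF mu]] Field_mu_le ordLeq_transitive by blast

lemma cf_Field_small: "|Field (cf \<mu>)| \<le>o \<mu>"
  by (rule card_le_subset[OF cf_Field Field_mu_le])

lemma below_cf_bounded:
  assumes "L \<subseteq> Field \<mu>" "|L| <o cf \<mu>"
  shows "\<exists>b\<in>Field \<mu>. \<forall>l\<in>L. l \<in> underS \<mu> b"
proof -
  have "\<not> cofinal L \<mu>" using cf_least[OF assms(1)] assms(2) not_ordLess_ordLeq by blast
  then obtain b where b: "b \<in> Field \<mu>" "\<And>l. l \<in> L \<Longrightarrow> \<not> (b \<noteq> l \<and> (b, l) \<in> \<mu>)"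
    unfolding cofinal_def by blast
  obtain b' where b': "b' \<in> Field \<mu>" "b \<noteq> b'" "(b, b') \<in> \<mu>"
    using infinite_Card_order_limit[OF mu_card mu_inf b(1)] by blast
  then have bb: "b \<in> underS \<mu> b'" unfolding underS_def by auto
  have "l \<in> underS \<mu> b'" if "l \<in> L" for l
  proof -
    have "b \<notin> underS \<mu> l" using b(2)[OF that] unfolding underS_def by auto
    then have "(l, b) \<in> \<mu>" using wo_underS_or[OF mu_wo, of l b] b(1) that assms(1) by blast
    then show ?thesis using wo_le_less_trans[OF mu_wo _ bb] by blast
  qed
  then show ?thesis using b' by blast
qed

lemma cf_infinite: "infinite (Field (cf \<mu>))"
proof
  assume "finite (Field (cf \<mu>))"
  moreover have "\<exists>b\<in>Field \<mu>. \<forall>l\<in>L. (l, b) \<in> \<mu>" if "finite L" "L \<subseteq> Field \<mu>" for L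
    using that
  proof (induction L)
    case empty
    obtain b where "b \<in> Field \<mu>" using mu_inf by fastforce
    then show ?case by blast
  next
    case (insert k L)
    then obtain b where b: "b \<in> Field \<mu>" "\<forall>l\<in>L. (l, b) \<in> \<mu>" by auto
    have k: "k \<in> Field \<mu>" using insert by auto
    show ?case
    proof (cases "(k, b) \<in> \<mu>")
      case False
      then have "b \<in> underS \<mu> k" using wo_underS_or[OF mu_wo k b(1)] by simp
      then have bk: "(b, k) \<in> \<mu>" by (rule underS_le)
      have "(l, k) \<in> \<mu>" if "l \<in> insert k L" for l
        using that wo_trans[OF mu_wo _ bk, of l] b(2) wo_refl[OF mu_wo k] by auto
      then show ?thesis using k by auto
    qed (use b in blast)
  qed
  ultimately obtain b where b: "b \<in> Field \<mu>" "\<forall>l\<in>Field (cf \<mu>). (l, b) \<in> \<mu>" using cf_Field by blast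
  then show False using cf_cofinal wo_antisym[OF mu_wo] unfolding cofinal_def by blast
qed

lemma cf_Cinf: "Cinfinite (cf \<mu>)"
  using cf_infinite cf_card by (simp add: cinfinite_def)

text \<open>The relation \<open>cf \<mu>\<close> is an arbitrary well-order of least type on a
  cofinal set, not the restriction of \<mu>. With \<open>rk m\<close> an element of that set above
  \<open>m\<close>, fewer than cf \<mu> ranks are at most \<open>k\<close>, so they have a common
  bound in \<mu>.\<close>

lemma cf_rank: "\<exists>rk. (\<forall>m\<in>Field \<mu>. rk m \<in> Field (cf \<mu>)) \<and>
    (\<forall>k\<in>Field (cf \<mu>). |{m\<in>Field \<mu>. (rk m, k) \<in> cf \<mu>}| <o \<mu>)"
proof -
  have "\<forall>m\<in>Field \<mu>. \<exists>k. k \<in> Field (cf \<mu>) \<and> m \<in> underS \<mu> k"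
    using cf_cofinal unfolding cofinal_def underS_def by blast
  from bchoice[OF this] obtain rk where rk: "\<And>m. m \<in> Field \<mu> \<Longrightarrow> rk m \<in> Field (cf \<mu>)"
    "\<And>m. m \<in> Field \<mu> \<Longrightarrow> m \<in> underS \<mu> (rk m)" by blast
  have "|{m\<in>Field \<mu>. (rk m, k) \<in> cf \<mu>}| <o \<mu>" if k: "k \<in> Field (cf \<mu>)" for k
  proof -
    have "{l. (l, k) \<in> cf \<mu>} \<subseteq> Field \<mu>" using cf_Field by (auto simp: Field_def)
    then obtain b where b: "b \<in> Field \<mu>" "\<And>l. (l, k) \<in> cf \<mu> \<Longrightarrow> l \<in> underS \<mu> b"
      using below_cf_bounded[OF _ card_under_less[OF cf_Cinf k]] by blast
    have "{m\<in>Field \<mu>. (rk m, k) \<in> cf \<mu>} \<subseteq> underS \<mu> b"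
    proof
      fix m assume "m \<in> {m\<in>Field \<mu>. (rk m, k) \<in> cf \<mu>}"
      then have "m \<in> underS \<mu> (rk m)" "rk m \<in> underS \<mu> b" using rk(2) b(2) by auto
      then show "m \<in> underS \<mu> b" using wo_less_le_trans[OF mu_wo _ underS_le] by metis
    qed
    then show ?thesis by (rule card_less_subset[OF _ card_of_underS[OF mu_card b(1)]])
  qed
  then show ?thesis using rk(1) by blast
qed

definition rk where "rk = (SOME rk. (\<forall>m\<in>Field \<mu>. rk m \<in> Field (cf \<mu>)) \<and>
    (\<forall>k\<in>Field (cf \<mu>). |{m\<in>Field \<mu>. (rk m, k) \<in> cf \<mu>}| <o \<mu>))"

lemma rk_Field: "m \<in> Field \<mu> \<Longrightarrow> rk m \<in> Field (cf \<mu>)"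
  and rk_less: "k \<in> Field (cf \<mu>) \<Longrightarrow> |{m\<in>Field \<mu>. (rk m, k) \<in> cf \<mu>}| <o \<mu>"
  using someI_ex[OF cf_rank] unfolding rk_def[symmetric] by auto

text \<open>As \<open>k\<close> runs through \<open>cf \<mu>\<close>, these sets increase to the set
  of all predecessors of \<open>x\<close>, while each has fewer than \<mu> elements.\<close>

definition below where "below k x = {y\<in>underS \<kappa> x. (rk (e x y), k) \<in> cf \<mu>}"

lemma below_less:
  assumes "x \<in> X" "k \<in> Field (cf \<mu>)"
  shows "|below k x| <o \<mu>"
proof -
  have "inj_on (e x) (below k x)"
    by (rule inj_on_subset[OF e_inj[OF assms(1)]]) (auto simp: below_def)
  then have "|below k x| \<le>o |{m\<in>Field \<mu>. (rk m, k) \<in> cf \<mu>}|"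
    by (rule card_le_inj) (use e_Field[OF assms(1)] in \<open>auto simp: below_def\<close>)
  then show ?thesis using rk_less[OF assms(2)] ordLeq_ordLess_trans by blast
qed

section \<open>Refinements ranked by the cofinality\<close>

text \<open>
  The sets \<open>a k x\<close> represent sets of ordinals in the generic ultrapower whose parts below \<open>\<kappa>\<close> are
  bounded but have suprema that are cofinal in \<open>\<kappa>\<close>.
\<close>

definition ranksys where
  "ranksys a q \<longleftrightarrow>
    (\<forall>q'\<subseteq>q. pos q' \<longrightarrow> (\<forall>k\<in>Field (cf \<mu>). \<exists>p\<subseteq>q'. pos p \<and> (\<exists>\<gamma>\<in>X. bdd (a k) \<gamma> p))) \<and>
    (\<forall>q'\<subseteq>q. pos q' \<longrightarrow> (\<forall>\<gamma>\<in>X. \<exists>k\<in>Field (cf \<mu>). \<exists>\<delta>. \<gamma> \<in> underS \<kappa> \<delta> \<and> pos {x\<in>q'. \<delta> \<in> a k x}))"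

lemma ranksys_bdd: "ranksys a q \<Longrightarrow> q' \<subseteq> q \<Longrightarrow> pos q' \<Longrightarrow> k \<in> Field (cf \<mu>) \<Longrightarrow>
    \<exists>p\<subseteq>q'. pos p \<and> (\<exists>\<gamma>\<in>X. bdd (a k) \<gamma> p)"
  and ranksys_cofinal: "ranksys a q \<Longrightarrow> q' \<subseteq> q \<Longrightarrow> pos q' \<Longrightarrow> \<gamma> \<in> X \<Longrightarrow>
    \<exists>k\<in>Field (cf \<mu>). \<exists>\<delta>. \<gamma> \<in> underS \<kappa> \<delta> \<and> pos {x\<in>q'. \<delta> \<in> a k x}"
  unfolding ranksys_def by simp_all

lemma ranksys_mono: "ranksys a q \<Longrightarrow> q' \<subseteq> q \<Longrightarrow> ranksys a q'"
  unfolding ranksys_def by (meson subset_trans)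

text \<open>If \<open>C\<close> is not \<open>uncofinal\<close>, some \<open>s\<close> on
  \<open>C\<close> stays at or above any given \<xi> from \<open>t \<xi>\<close> on. For
  \<open>c\<close> in \<open>C\<close>, a \<open>k\<close> in the cofinal set above
  \<open>s c\<close> has \<open>t k\<close> beyond \<open>c\<close>. So the terms at
  \<open>t k\<close> form a cofinal subsequence indexed by cf \<mu>, and their singletons are
  bounded because the terms are locally constant.\<close>

lemma ranksys_of_cofseq:
  assumes cs: "cofseq C z q" and un: "\<not> uncofinal C"
  shows "\<exists>a. ranksys a q"
proof -
  obtain s where s: "\<forall>c\<in>C. s c \<in> Field \<mu>"
    "\<forall>\<xi>\<in>Field \<mu>. \<exists>c. c \<in> C \<and> (\<forall>d\<in>C. (c, d) \<in> \<mu> \<longrightarrow> s d \<notin> underS \<mu> \<xi>)"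
    using un unfolding uncofinal_def by blast
  from bchoice[OF s(2)] obtain t where t: "\<And>\<xi>. \<xi> \<in> Field \<mu> \<Longrightarrow> t \<xi> \<in> C"
    "\<And>\<xi> d. \<xi> \<in> Field \<mu> \<Longrightarrow> d \<in> C \<Longrightarrow> (t \<xi>, d) \<in> \<mu> \<Longrightarrow> s d \<notin> underS \<mu> \<xi>" by blast
  have CF: "C \<subseteq> Field \<mu>" using cs unfolding cofseq_def by blast
  have zX: "z c x \<in> X" if "x \<in> q" "c \<in> C" for c x using cs that unfolding cofseq_def by blast
  define a where "a k x = {z (t k) x}" for k x
  have tk: "t k \<in> C" if "k \<in> Field (cf \<mu>)" for k using t(1) cf_Field that by blast
  have lc: "\<exists>\<gamma>\<in>X. pos {x\<in>q'. z (t k) x = \<gamma>}" if "q' \<subseteq> q" "pos q'" "k \<in> Field (cf \<mu>)" for q' k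
    using cs tk[OF that(3)] that(1,2) unfolding cofseq_def loc_const_def by blast
  have "ranksys a q" unfolding ranksys_def
  proof (intro conjI allI impI ballI)
    fix q' k assume q': "q' \<subseteq> q" "pos q'" and k: "k \<in> Field (cf \<mu>)"
    obtain \<gamma> where g: "\<gamma> \<in> X" "pos {x\<in>q'. z (t k) x = \<gamma>}" using lc[OF q' k] by blast
    have "bdd (a k) \<gamma> {x\<in>q'. z (t k) x = \<gamma>}" unfolding bdd_def
    proof (intro allI impI)
      fix \<delta> assume "\<gamma> \<in> underS \<kappa> \<delta>"
      then have "{x\<in>{x\<in>q'. z (t k) x = \<gamma>}. \<delta> \<in> a k x} = {}" unfolding a_def underS_def by auto
      then show "{x\<in>{x\<in>q'. z (t k) x = \<gamma>}. \<delta> \<in> a k x} \<in> I" using null_empty by (simp only:)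
    qed
    with g show "\<exists>p\<subseteq>q'. pos p \<and> (\<exists>\<gamma>\<in>X. bdd (a k) \<gamma> p)"
      by (intro exI[of _ "{x\<in>q'. z (t k) x = \<gamma>}"]) blast
  next
    fix q' \<gamma> assume q': "q' \<subseteq> q" "pos q'" and g: "\<gamma> \<in> X"
    let ?N = "{x\<in>q. \<forall>c\<in>C. (z c x, \<gamma>) \<in> \<kappa>}"
    have N: "?N \<in> I" using cs g unfolding cofseq_def by blast
    have pos1: "pos (q' - ?N)" by (rule pos_diff[OF q'(2) N]) auto
    have ex: "\<exists>k\<in>Field (cf \<mu>). \<gamma> \<in> underS \<kappa> (z (t k) x)" if x: "x \<in> q' - ?N" for x
    proof -
      have xq: "x \<in> q" using x q'(1) by blast
      obtain c where c: "c \<in> C" "(z c x, \<gamma>) \<notin> \<kappa>" using x xq by blast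
      obtain k where k: "k \<in> Field (cf \<mu>)" "s c \<in> underS \<mu> k"
        using cf_cofinal s(1) c(1) unfolding cofinal_def underS_def by blast
      have kF: "k \<in> Field \<mu>" using k(1) cf_Field by blast
      have "(t k, c) \<notin> \<mu>" using t(2)[OF kF c(1)] k(2) by blast
      moreover have "t k \<in> Field \<mu>" "c \<in> Field \<mu>" using CF c(1) tk[OF k(1)] by auto
      ultimately have "c \<in> underS \<mu> (t k)" using wo_underS_or[OF mu_wo] by metis
      then have "(c, t k) \<in> \<mu>" by (rule underS_le)
      then have "(z c x, z (t k) x) \<in> \<kappa>" using cs xq c(1) tk[OF k(1)] unfolding cofseq_def by blast
      then have "(z (t k) x, \<gamma>) \<notin> \<kappa>" using c(2) wo_trans[OF kappa_wo] by blast
      then have "\<gamma> \<in> underS \<kappa> (z (t k) x)"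
        using wo_underS_or[OF kappa_wo zX[OF xq tk[OF k(1)]] g] by blast
      then show ?thesis using k(1) by blast
    qed
    obtain k where k: "k \<in> Field (cf \<mu>)" "pos {x\<in>q' - ?N. \<gamma> \<in> underS \<kappa> (z (t k) x)}" (is "pos ?p")
      using pos_split[OF pos1 cf_Field_small, of "\<lambda>x k. \<gamma> \<in> underS \<kappa> (z (t k) x)"] ex by blast
    have "?p \<subseteq> q" using q'(1) by blast
    then obtain \<delta> where d: "pos {x\<in>?p. z (t k) x = \<delta>}" using lc[OF _ k(2,1)] by blast
    have "\<gamma> \<in> underS \<kappa> \<delta>" using pos_nonempty[OF d] by blast
    moreover have "pos {x\<in>q'. \<delta> \<in> a k x}"
      by (rule pos_mono[OF d]) (use pos_sub[OF q'(2)] in \<open>auto simp: a_def\<close>)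
    ultimately show "\<exists>k\<in>Field (cf \<mu>). \<exists>\<delta>. \<gamma> \<in> underS \<kappa> \<delta> \<and> pos {x\<in>q'. \<delta> \<in> a k x}" using k(1) by blast
  qed
  then show ?thesis by blast
qed

text \<open>Cofinality is automatic: any \<delta> above \<gamma> is below almost all
  \<open>x\<close>, and the rank of its code takes at most cf \<mu> values, so one rank occurs on a
  positive set.\<close>

lemma ranksys_below:
  assumes q: "q \<subseteq> X"
    and b: "\<And>q' k. q' \<subseteq> q \<Longrightarrow> pos q' \<Longrightarrow> k \<in> Field (cf \<mu>) \<Longrightarrow> \<exists>p\<subseteq>q'. pos p \<and> (\<exists>\<gamma>\<in>X. bdd (below k) \<gamma> p)"
  shows "ranksys below q"
  unfolding ranksys_def
proof (intro conjI allI impI ballI)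
  fix q' \<gamma> assume q': "q' \<subseteq> q" "pos q'" and g: "\<gamma> \<in> X"
  obtain \<delta> where d: "\<delta> \<in> X" "\<gamma> \<in> underS \<kappa> \<delta>"
    using infinite_Card_order_limit[OF kappa_card _ g] kappa_Cinf unfolding cinfinite_def underS_def by auto
  let ?p = "q' - {y. (y, \<delta>) \<in> \<kappa>}"
  have p: "pos ?p" by (rule pos_diff[OF q'(2) null_under[OF d(1)]]) auto
  have lt: "\<delta> \<in> underS \<kappa> x" if "x \<in> ?p" for x
    using wo_underS_or[OF kappa_wo _ d(1), of x] that pos_sub[OF p] by blast
  have rkF: "rk (e x \<delta>) \<in> Field (cf \<mu>)" if "x \<in> ?p" for x
    using rk_Field e_Field pos_sub[OF p] that by blast
  obtain k where k: "k \<in> Field (cf \<mu>)" "pos {x\<in>?p. rk (e x \<delta>) = k}"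
    using pos_split[OF p cf_Field_small, of "\<lambda>x k. rk (e x \<delta>) = k"] rkF by blast
  have "pos {x\<in>q'. \<delta> \<in> below k x}"
  proof (rule pos_mono[OF k(2)])
    show "{x\<in>?p. rk (e x \<delta>) = k} \<subseteq> {x\<in>q'. \<delta> \<in> below k x}"
      using lt wo_refl[OF cf_wo k(1)] unfolding below_def by blast
  qed (use pos_sub[OF q'(2)] in auto)
  then show "\<exists>k\<in>Field (cf \<mu>). \<exists>\<delta>. \<gamma> \<in> underS \<kappa> \<delta> \<and> pos {x\<in>q'. \<delta> \<in> below k x}" using k(1) d(2) by blast
qed (use b in blast)

text \<open>\<open>c i\<close> is the least rank whose set has an element \<open>d i\<close> beyond
  \<open>i\<close> on a positive part of \<open>A i\<close>, and \<open>g i\<close> bounds that set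
  on a smaller part \<open>p i\<close>. Let \<open>i\<close> be below \<open>j\<close> and
  \<open>p i\<close> meet \<open>p j\<close> in a positive set. A rank \<open>c j\<close> below
  \<open>c i\<close> is impossible, as \<open>a (c j)\<close> has almost nowhere on
  \<open>A i\<close> the element \<open>d j\<close> beyond \<open>i\<close>. For equal ranks
  \<open>d j\<close>, and so \<open>j\<close>, lies below the bound \<open>g i\<close>, which leaves
  at most \<mu> conflicts for \<open>sparse_refinement\<close>.\<close>

lemma ranksys_refinement:
  assumes J: "J \<subseteq> X" and sys: "\<forall>i\<in>J. pos (A i) \<and> ranksys a (A i)"
  shows "\<exists>B c. (\<forall>i\<in>J. pos (B i) \<and> B i \<subseteq> A i \<and> c i \<in> Field (cf \<mu>)) \<and>
    (\<forall>i\<in>J. \<forall>j\<in>J. i \<in> underS \<kappa> j \<longrightarrow> B i \<inter> B j \<in> I \<or> c i \<in> underS (cf \<mu>) (c j))"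
proof -
  have A: "pos (A i) \<and> ranksys a (A i)" if "i \<in> J" for i using sys that by blast
  have "\<exists>k\<in>Field (cf \<mu>). (\<exists>\<delta>. i \<in> underS \<kappa> \<delta> \<and> pos {x\<in>A i. \<delta> \<in> a k x}) \<and>
      (\<forall>l\<in>underS (cf \<mu>) k. bdd (a l) i (A i))" if i: "i \<in> J" for i
  proof -
    let ?S = "{k\<in>Field (cf \<mu>). \<exists>\<delta>. i \<in> underS \<kappa> \<delta> \<and> pos {x\<in>A i. \<delta> \<in> a k x}}"
    have "ranksys a (A i)" "pos (A i)" "i \<in> X" using A[OF i] i J by auto
    then have "\<exists>k\<in>Field (cf \<mu>). \<exists>\<delta>. i \<in> underS \<kappa> \<delta> \<and> pos {x\<in>A i. \<delta> \<in> a k x}"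
      by (intro ranksys_cofinal[OF _ subset_refl])
    then have "?S \<noteq> {}" by auto
    then obtain k where k: "k \<in> ?S" "\<And>l. l \<in> ?S \<Longrightarrow> (k, l) \<in> cf \<mu>"
      using wo_least[OF cf_wo, of ?S] by blast
    have "bdd (a l) i (A i)" if l: "l \<in> underS (cf \<mu>) k" for l
    proof -
      have "l \<notin> ?S" using k(2) wo_not_le[OF cf_wo l] by blast
      then have "\<not> pos {x\<in>A i. \<delta> \<in> a l x}" if "i \<in> underS \<kappa> \<delta>" for \<delta>
        using that in_underS_Field[OF l] by blast
      moreover have "A i \<subseteq> X" using A[OF i] pos_sub by blast
      ultimately show ?thesis unfolding bdd_def pos_def by blast
    qed
    then show ?thesis using k(1) by blast
  qed
  then have "\<forall>i\<in>J. \<exists>k. k \<in> Field (cf \<mu>) \<and> (\<exists>\<delta>. i \<in> underS \<kappa> \<delta> \<and> pos {x\<in>A i. \<delta> \<in> a k x}) \<and>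
      (\<forall>l\<in>underS (cf \<mu>) k. bdd (a l) i (A i))" by blast
  from bchoice[OF this] obtain c where c: "\<And>i. i \<in> J \<Longrightarrow> c i \<in> Field (cf \<mu>)"
    "\<forall>i\<in>J. \<exists>\<delta>. i \<in> underS \<kappa> \<delta> \<and> pos {x\<in>A i. \<delta> \<in> a (c i) x}"
    "\<And>i l. i \<in> J \<Longrightarrow> l \<in> underS (cf \<mu>) (c i) \<Longrightarrow> bdd (a l) i (A i)" by blast
  from bchoice[OF c(2)] obtain d where d: "\<And>i. i \<in> J \<Longrightarrow> i \<in> underS \<kappa> (d i)"
    "\<And>i. i \<in> J \<Longrightarrow> pos {x\<in>A i. d i \<in> a (c i) x}" by blast
  have "\<forall>i\<in>J. \<exists>p. p \<subseteq> {x\<in>A i. d i \<in> a (c i) x} \<and> pos p \<and> (\<exists>\<gamma>\<in>X. bdd (a (c i)) \<gamma> p)"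
  proof
    fix i assume i: "i \<in> J"
    have "{x\<in>A i. d i \<in> a (c i) x} \<subseteq> A i" by blast
    then show "\<exists>p. p \<subseteq> {x\<in>A i. d i \<in> a (c i) x} \<and> pos p \<and> (\<exists>\<gamma>\<in>X. bdd (a (c i)) \<gamma> p)"
      using A[OF i] c(1)[OF i] d(2)[OF i] ranksys_bdd[of a "A i"] by simp
  qed
  from bchoice[OF this] obtain p where
    "\<forall>i\<in>J. p i \<subseteq> {x\<in>A i. d i \<in> a (c i) x} \<and> pos (p i) \<and> (\<exists>\<gamma>\<in>X. bdd (a (c i)) \<gamma> (p i))" by (rule exE)
  then have p: "\<And>i. i \<in> J \<Longrightarrow> p i \<subseteq> {x\<in>A i. d i \<in> a (c i) x}"
    "\<And>i. i \<in> J \<Longrightarrow> pos (p i)" "\<forall>i\<in>J. \<exists>\<gamma>. \<gamma> \<in> X \<and> bdd (a (c i)) \<gamma> (p i)" by (simp_all add: Bex_def)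
  from bchoice[OF p(3)] obtain g where g: "\<And>i. i \<in> J \<Longrightarrow> g i \<in> X"
    "\<And>i. i \<in> J \<Longrightarrow> bdd (a (c i)) (g i) (p i)" by blast
  have key: "(d j, \<gamma>) \<in> \<kappa>" if "j \<in> J" "bdd (a (c j)) \<gamma> q" "p j \<inter> q \<notin> I" "\<gamma> \<in> X" for j q \<gamma>
  proof (rule ccontr)
    assume "(d j, \<gamma>) \<notin> \<kappa>"
    then have "\<gamma> \<in> underS \<kappa> (d j)"
      using wo_underS_or[OF kappa_wo underS_in_Field[OF d(1)[OF that(1)]] that(4)] by blast
    then have "{x\<in>q. d j \<in> a (c j) x} \<in> I" using that(2) unfolding bdd_def by blast
    moreover have "p j \<inter> q \<subseteq> {x\<in>q. d j \<in> a (c j) x}" using p(1)[OF that(1)] by blast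
    ultimately show False using null_subset that(3) by blast
  qed
  define R where "R = {(i, j). i \<in> J \<and> j \<in> J \<and> c i = c j \<and> p i \<inter> p j \<notin> I}"
  have RJ: "R \<subseteq> J \<times> J" unfolding R_def by auto
  have symR: "sym R" unfolding R_def sym_def by (auto simp: Int_commute)
  have deg: "|R `` {i}| \<le>o \<mu>" if i: "i \<in> J" for i
  proof (rule card_le_subset[OF _ small_under[OF g(1)[OF i]]])
    show "R `` {i} \<subseteq> {y. (y, g i) \<in> \<kappa>}"
    proof
      fix j assume "j \<in> R `` {i}"
      then have j: "j \<in> J" "c i = c j" "p j \<inter> p i \<notin> I" unfolding R_def by (auto simp: Int_commute)
      have "(d j, g i) \<in> \<kappa>" using key[OF j(1) _ j(3) g(1)[OF i]] g(2)[OF i] j(2) by simp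
      then show "j \<in> {y. (y, g i) \<in> \<kappa>}" using wo_trans[OF kappa_wo underS_le[OF d(1)[OF j(1)]]] by blast
    qed
  qed
  obtain B where B: "\<And>i. i \<in> J \<Longrightarrow> pos (B i) \<and> B i \<subseteq> p i"
    "\<And>i j. (i, j) \<in> R \<Longrightarrow> i \<noteq> j \<Longrightarrow> B i \<inter> B j = {}"
    using sparse_refinement[OF RJ symR deg, of p] p(2) by blast
  have "B i \<inter> B j \<in> I \<or> c i \<in> underS (cf \<mu>) (c j)" if i: "i \<in> J" and j: "j \<in> J" and ij: "i \<in> underS \<kappa> j" for i j
  proof (rule ccontr)
    assume n: "\<not> ?thesis"
    have "B i \<inter> B j \<subseteq> p i \<inter> p j" using B(1)[OF i] B(1)[OF j] by blast
    then have pij: "p i \<inter> p j \<notin> I" using n null_subset by blast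
    have "(c j, c i) \<in> cf \<mu>" using wo_underS_or[OF cf_wo c(1)[OF j] c(1)[OF i]] n by blast
    then consider "c j = c i" | "c j \<in> underS (cf \<mu>) (c i)" unfolding underS_def by blast
    then show False
    proof cases
      case 1
      then have "(i, j) \<in> R" "i \<noteq> j" using i j pij ij unfolding R_def underS_def by auto
      then have "B i \<inter> B j = {}" by (rule B(2))
      then show False using n null_empty by simp
    next
      case 2
      have "bdd (a (c j)) i (p i)"
        by (rule bdd_mono[OF c(3)[OF i 2]]) (use p(1)[OF i] in blast)
      moreover have "p j \<inter> p i \<notin> I" using pij by (simp add: Int_commute)
      ultimately have "(d j, i) \<in> \<kappa>" using key[OF j] i J by blast
      then show False
        using wo_not_le[OF kappa_wo wo_less_le_trans[OF kappa_wo ij underS_le[OF d(1)[OF j]]]] by blast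
    qed
  qed
  moreover have "pos (B i) \<and> B i \<subseteq> A i \<and> c i \<in> Field (cf \<mu>)" if "i \<in> J" for i
    using B(1)[OF that] p(1)[OF that] c(1)[OF that] by blast
  ultimately show ?thesis by (intro exI[of _ B] exI[of _ c]) blast
qed

text \<open>A kind contains its witnesses, so that all sets of one kind share one sequence or one
  system of ranks, as the two refinement lemmas require.\<close>

definition kind where
  "kind k q \<longleftrightarrow> (case k of Inl (C, z) \<Rightarrow> cofseq C z q \<and> uncofinal C | Inr a \<Rightarrow> ranksys a q)"

lemma kind_dense:
  assumes "pos A"
  shows "\<exists>k q. pos q \<and> q \<subseteq> A \<and> kind k q"
proof (cases "\<exists>q k. q \<subseteq> A \<and> pos q \<and> k \<in> Field (cf \<mu>) \<and>
    (\<forall>p \<gamma>. p \<subseteq> q \<longrightarrow> pos p \<longrightarrow> \<gamma> \<in> X \<longrightarrow> \<not> bdd (below k) \<gamma> p)")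
  case False
  then have "\<exists>p\<subseteq>q. pos p \<and> (\<exists>\<gamma>\<in>X. bdd (below k) \<gamma> p)" if "q \<subseteq> A" "pos q" "k \<in> Field (cf \<mu>)" for q k
    using that by metis
  then have "ranksys below A" by (rule ranksys_below[OF pos_sub[OF assms]])
  then have "kind (Inr below) A" unfolding kind_def by simp
  then show ?thesis using assms by blast
next
  case True
  then obtain q k where q: "q \<subseteq> A" "pos q" "k \<in> Field (cf \<mu>)"
    and n: "\<forall>p \<gamma>. p \<subseteq> q \<longrightarrow> pos p \<longrightarrow> \<gamma> \<in> X \<longrightarrow> \<not> bdd (below k) \<gamma> p" by (elim exE conjE)
  have "\<forall>x\<in>q. below k x \<subseteq> X \<and> |below k x| <o \<mu>"
  proof (intro ballI conjI)
    fix x assume "x \<in> q"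
    then show "|below k x| <o \<mu>" using below_less[OF _ q(3)] pos_sub[OF q(2)] by auto
    show "below k x \<subseteq> X" unfolding below_def using in_underS_Field[of _ \<kappa> x] by auto
  qed
  from unbounded_cofseq[OF q(2) this n] obtain C z q' where q': "q' \<subseteq> q" "pos q'" "cofseq C z q'"
    by (elim exE conjE)
  show ?thesis
  proof (cases "uncofinal C")
    case True
    then have "kind (Inl (C, z)) q'" using q'(3) unfolding kind_def by simp
    then show ?thesis using q' q(1) by blast
  next
    case F: False
    then obtain a where "ranksys a q'" using ranksys_of_cofseq[OF q'(3)] by blast
    then have "kind (Inr a) q'" unfolding kind_def by simp
    then show ?thesis using q' q(1) by blast
  qed
qed

lemma kind_mono: "kind k q \<Longrightarrow> q' \<subseteq> q \<Longrightarrow> kind k q'"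
  unfolding kind_def by (auto intro: cofseq_mono ranksys_mono split: sum.splits)

lemma X_le_kappa: "J \<subseteq> X \<Longrightarrow> |J| \<le>o \<kappa>"
  using card_le_subset[of J X] card_of_Field_ordIso[OF kappa_card] ordIso_imp_ordLeq by blast

lemma ranked_refinement:
  assumes "\<forall>i\<in>X. pos (A i)"
  shows "\<exists>B c. (\<forall>i\<in>X. pos (B i) \<and> B i \<subseteq> A i \<and> c i \<in> Field (cf \<mu>)) \<and>
    (\<forall>i\<in>X. \<forall>j\<in>X. i \<in> underS \<kappa> j \<longrightarrow> B i \<inter> B j = {} \<or> c i \<in> underS (cf \<mu>) (c j))"
proof -
  have A: "pos (A i)" if "i \<in> X" for i using assms that by simp
  \<comment> \<open>\<open>kindwise_refinement\<close> meets each pair in either order, so the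
    condition on ranks is stated for both.\<close>
  define Q where "Q i j ci cj \<longleftrightarrow> (i \<in> underS \<kappa> j \<longrightarrow> ci \<in> underS (cf \<mu>) cj) \<and> (j \<in> underS \<kappa> i \<longrightarrow> cj \<in> underS (cf \<mu>) ci)" for i j ci cj
  have "\<exists>B c. (\<forall>i\<in>X. pos (B i) \<and> B i \<subseteq> A i \<and> c i \<in> Field (cf \<mu>)) \<and>
      (\<forall>i\<in>X. \<forall>j\<in>X. i \<noteq> j \<longrightarrow> B i \<inter> B j \<in> I \<or> Q i j (c i) (c j))"
  proof (rule kindwise_refinement[where P = kind])
    show "kind k q'" if "kind k q" "pos q'" "q' \<subseteq> q" for k q q' using kind_mono that by blast
    show "\<exists>k q. pos q \<and> q \<subseteq> A i \<and> kind k q" if "i \<in> X" for i by (rule kind_dense[OF A[OF that]])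
    fix k K q assume K: "K \<subseteq> X" and q: "\<And>i. i \<in> K \<Longrightarrow> pos (q i) \<and> q i \<subseteq> A i \<and> kind k (q i)"
    show "\<exists>B c. (\<forall>i\<in>K. pos (B i) \<and> B i \<subseteq> q i \<and> c i \<in> Field (cf \<mu>)) \<and>
        (\<forall>i\<in>K. \<forall>j\<in>K. i \<noteq> j \<longrightarrow> B i \<inter> B j \<in> I \<or> Q i j (c i) (c j))"
    proof (cases k)
      case (Inr a)
      have "\<forall>i\<in>K. pos (q i) \<and> ranksys a (q i)" using q Inr unfolding kind_def by simp
      from ranksys_refinement[OF K this] obtain B c where
        Bc: "\<forall>i\<in>K. pos (B i) \<and> B i \<subseteq> q i \<and> c i \<in> Field (cf \<mu>)"
        "\<forall>i\<in>K. \<forall>j\<in>K. i \<in> underS \<kappa> j \<longrightarrow> B i \<inter> B j \<in> I \<or> c i \<in> underS (cf \<mu>) (c j)" by blast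
      have "B i \<inter> B j \<in> I \<or> Q i j (c i) (c j)" if "i \<in> K" "j \<in> K" for i j
        using Bc(2) that unfolding Q_def by (metis Int_commute)
      with Bc(1) show ?thesis by (intro exI[of _ B] exI[of _ c]) blast
    next
      case (Inl Cz)
      obtain C z where "Cz = (C, z)" by (cases Cz)
      then have cs: "\<forall>i\<in>K. pos (q i) \<and> cofseq C z (q i) \<and> uncofinal C"
        using q Inl unfolding kind_def by simp
      \<comment> \<open>Almost disjoint sets put no condition on the ranks, so a constant rank
        serves.\<close>
      obtain k0 where k0: "k0 \<in> Field (cf \<mu>)" using cf_infinite by fastforce
      show ?thesis
      proof (cases "K = {}")
        case False
        with cs have "\<forall>i\<in>K. pos (q i) \<and> cofseq C z (q i)" "uncofinal C" by auto
        from cofseq_refinement[OF X_le_kappa[OF K] this] obtain B where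
          "\<forall>i\<in>K. pos (B i) \<and> B i \<subseteq> q i" "\<forall>i\<in>K. \<forall>j\<in>K. i \<noteq> j \<longrightarrow> B i \<inter> B j \<in> I" by (elim exE conjE)
        then show ?thesis using k0 by (intro exI[of _ B] exI[of _ "\<lambda>_. k0"]) simp
      qed simp
    qed
  qed
  then obtain B c where "\<forall>i\<in>X. pos (B i) \<and> B i \<subseteq> A i \<and> c i \<in> Field (cf \<mu>)"
    "\<forall>i\<in>X. \<forall>j\<in>X. i \<noteq> j \<longrightarrow> B i \<inter> B j \<in> I \<or> Q i j (c i) (c j)" by (elim exE conjE)
  then have B: "\<And>i. i \<in> X \<Longrightarrow> pos (B i) \<and> B i \<subseteq> A i \<and> c i \<in> Field (cf \<mu>)"
    and Q: "\<And>i j. i \<in> X \<Longrightarrow> j \<in> X \<Longrightarrow> i \<noteq> j \<Longrightarrow> B i \<inter> B j \<in> I \<or> Q i j (c i) (c j)" by simp_all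
  obtain B' where B': "\<And>i. i \<in> X \<Longrightarrow> pos (B' i) \<and> B' i \<subseteq> B i"
    "\<And>i j. i \<in> X \<Longrightarrow> j \<in> X \<Longrightarrow> i \<noteq> j \<Longrightarrow> B i \<inter> B j \<in> I \<Longrightarrow> B' i \<inter> B' j = {}"
    using disjointify[of B] B by blast
  have "B' i \<inter> B' j = {} \<or> c i \<in> underS (cf \<mu>) (c j)" if "i \<in> X" "j \<in> X" "i \<in> underS \<kappa> j" for i j
  proof -
    have "i \<noteq> j" using that(3) unfolding underS_def by auto
    then show ?thesis using Q[OF that(1,2)] B'(2)[OF that(1,2)] that(3) unfolding Q_def by blast
  qed
  moreover have "pos (B' i) \<and> B' i \<subseteq> A i \<and> c i \<in> Field (cf \<mu>)" if "i \<in> X" for i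
    using B[OF that] B'(1)[OF that] by blast
  ultimately show ?thesis by (intro exI[of _ B'] exI[of _ c]) blast
qed

text \<open>\<open>Z x\<close> takes the place of \<open>below k x\<close>. If it is bounded by
  \<gamma> on \<open>q i\<close>, only indices up to \<gamma> can conflict with \<open>i\<close>. If
  it is nowhere bounded, the resulting sequence has fewer than cf \<mu> terms and is
  \<open>uncofinal\<close>, since so few values of \<open>s\<close> are bounded in \<mu>.\<close>

lemma point_sparse_refinement:
  assumes A: "\<And>i. i \<in> X \<Longrightarrow> pos (A i)" and sparse: "\<And>x. x \<in> X \<Longrightarrow> |{i\<in>X. x \<in> A i}| <o cf \<mu>"
  shows "\<exists>B. (\<forall>i\<in>X. pos (B i) \<and> B i \<subseteq> A i) \<and> (\<forall>i\<in>X. \<forall>j\<in>X. i \<noteq> j \<longrightarrow> B i \<inter> B j = {})"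
proof -
  define Z where "Z x = {i\<in>X. x \<in> A i}" for x
  define P where "P k q \<longleftrightarrow> (case k of None \<Rightarrow> \<exists>\<gamma>\<in>X. bdd Z \<gamma> q | Some (C, z) \<Rightarrow> cofseq C z q \<and> uncofinal C)" for k q
  have "\<exists>B c. (\<forall>i\<in>X. pos (B i) \<and> B i \<subseteq> A i \<and> c i \<in> (UNIV :: unit set)) \<and>
      (\<forall>i\<in>X. \<forall>j\<in>X. i \<noteq> j \<longrightarrow> B i \<inter> B j \<in> I \<or> False)"
  proof (rule kindwise_refinement[where P = P])
    show "P k q'" if "P k q" "pos q'" "q' \<subseteq> q" for k q q'
      using that bdd_mono[of Z _ q q'] cofseq_mono[of _ _ q q'] unfolding P_def by (auto split: option.splits)
    show "\<exists>k q. pos q \<and> q \<subseteq> A i \<and> P k q" if i: "i \<in> X" for i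
    proof (cases "\<exists>q\<subseteq>A i. pos q \<and> (\<exists>\<gamma>\<in>X. bdd Z \<gamma> q)")
      case True
      then obtain q where q: "q \<subseteq> A i" "pos q" "\<exists>\<gamma>\<in>X. bdd Z \<gamma> q" by blast
      then have "P None q" unfolding P_def by simp
      then show ?thesis using q by blast
    next
      case False
      then have n: "\<forall>q \<gamma>. q \<subseteq> A i \<longrightarrow> pos q \<longrightarrow> \<gamma> \<in> X \<longrightarrow> \<not> bdd Z \<gamma> q" by metis
      have "\<forall>x\<in>A i. Z x \<subseteq> X \<and> |Z x| <o \<mu>"
      proof (intro ballI conjI)
        fix x assume "x \<in> A i"
        then have "|Z x| <o cf \<mu>" using sparse[of x] pos_sub[OF A[OF i]] unfolding Z_def by auto
        then show "|Z x| <o \<mu>" using cf_le ordLess_ordLeq_trans by blast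
        show "Z x \<subseteq> X" unfolding Z_def by auto
      qed
      from unbounded_cofseq[OF A[OF i] this n] obtain C z q x where
        q: "q \<subseteq> A i" "pos q" "cofseq C z q" "x \<in> A i" "|C| \<le>o |Z x|" by (elim exE conjE bexE)
      have "|Z x| <o cf \<mu>" using sparse[of x] pos_sub[OF A[OF i]] q(4) unfolding Z_def by blast
      then have C: "|C| <o cf \<mu>" using q(5) ordLeq_ordLess_trans by blast
      have CF: "C \<subseteq> Field \<mu>" using q(3) unfolding cofseq_def by blast
      have "uncofinal C" unfolding uncofinal_def
      proof (intro allI impI)
        fix s assume s: "\<forall>c\<in>C. s c \<in> Field \<mu>"
        have "|s ` C| <o cf \<mu>" using C card_of_image ordLeq_ordLess_trans by blast
        then obtain b where "b \<in> Field \<mu>" "\<forall>l\<in>s ` C. l \<in> underS \<mu> b"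
          using below_cf_bounded[of "s ` C"] s by blast
        then show "\<exists>\<xi>\<in>Field \<mu>. \<forall>c\<in>C. \<exists>d\<in>C. (c, d) \<in> \<mu> \<and> s d \<in> underS \<mu> \<xi>"
          using wo_refl[OF mu_wo] CF by blast
      qed
      then have "P (Some (C, z)) q" using q(3) unfolding P_def by simp
      then show ?thesis using q by blast
    qed
    fix k K q assume K: "K \<subseteq> X" and q: "\<And>i. i \<in> K \<Longrightarrow> pos (q i) \<and> q i \<subseteq> A i \<and> P k (q i)"
    have "\<exists>B. (\<forall>i\<in>K. pos (B i) \<and> B i \<subseteq> q i) \<and> (\<forall>i\<in>K. \<forall>j\<in>K. i \<noteq> j \<longrightarrow> B i \<inter> B j \<in> I)"
    proof (cases k)
      case None
      then have "\<forall>i\<in>K. \<exists>\<gamma>. \<gamma> \<in> X \<and> bdd Z \<gamma> (q i)" using q unfolding P_def by auto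
      from bchoice[OF this] obtain g where g: "\<And>i. i \<in> K \<Longrightarrow> g i \<in> X" "\<And>i. i \<in> K \<Longrightarrow> bdd Z (g i) (q i)" by blast
      define R where "R = {(i, j). i \<in> K \<and> j \<in> K \<and> q i \<inter> q j \<notin> I}"
      have RK: "R \<subseteq> K \<times> K" unfolding R_def by auto
      have symR: "sym R" unfolding R_def sym_def by (auto simp: Int_commute)
      have deg: "|R `` {i}| \<le>o \<mu>" if i: "i \<in> K" for i
      proof (rule card_le_subset[OF _ small_under[OF g(1)[OF i]]], rule subsetI, rule ccontr)
        fix j assume "j \<in> R `` {i}" "j \<notin> {y. (y, g i) \<in> \<kappa>}"
        then have j: "j \<in> K" "q i \<inter> q j \<notin> I" "(j, g i) \<notin> \<kappa>" unfolding R_def by auto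
        have jX: "j \<in> X" using j(1) K by blast
        have "g i \<in> underS \<kappa> j" using wo_underS_or[OF kappa_wo jX g(1)[OF i]] j(3) by blast
        then have "{x\<in>q i. j \<in> Z x} \<in> I" using g(2)[OF i] unfolding bdd_def by blast
        moreover have "q i \<inter> q j \<subseteq> {x\<in>q i. j \<in> Z x}" using q[OF j(1)] jX unfolding Z_def by blast
        ultimately show False using null_subset j(2) by blast
      qed
      obtain B where B: "\<And>i. i \<in> K \<Longrightarrow> pos (B i) \<and> B i \<subseteq> q i"
        "\<And>i j. (i, j) \<in> R \<Longrightarrow> i \<noteq> j \<Longrightarrow> B i \<inter> B j = {}"
        using sparse_refinement[OF RK symR deg, of q] q by blast
      have "B i \<inter> B j \<in> I" if "i \<in> K" "j \<in> K" "i \<noteq> j" for i j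
      proof (cases "(i, j) \<in> R")
        case True
        then show ?thesis using B(2)[OF True that(3)] null_empty by simp
      next
        case False
        then have "q i \<inter> q j \<in> I" using that unfolding R_def by blast
        then show ?thesis by (rule null_subset) (use B(1)[OF that(1)] B(1)[OF that(2)] in blast)
      qed
      then show ?thesis using B(1) by (intro exI[of _ B]) blast
    next
      case (Some Cz)
      obtain C z where "Cz = (C, z)" by (cases Cz)
      then have cs: "\<forall>i\<in>K. pos (q i) \<and> cofseq C z (q i) \<and> uncofinal C"
        using q Some unfolding P_def by simp
      show ?thesis
      proof (cases "K = {}")
        case False
        with cs have "\<forall>i\<in>K. pos (q i) \<and> cofseq C z (q i)" "uncofinal C" by auto
        from cofseq_refinement[OF X_le_kappa[OF K] this] obtain B where
          "\<forall>i\<in>K. pos (B i) \<and> B i \<subseteq> q i" "\<forall>i\<in>K. \<forall>j\<in>K. i \<noteq> j \<longrightarrow> B i \<inter> B j \<in> I" by (elim exE conjE)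
        then show ?thesis by (intro exI[of _ B]) simp
      qed simp
    qed
    then show "\<exists>B c. (\<forall>i\<in>K. pos (B i) \<and> B i \<subseteq> q i \<and> c i \<in> (UNIV :: unit set)) \<and>
        (\<forall>i\<in>K. \<forall>j\<in>K. i \<noteq> j \<longrightarrow> B i \<inter> B j \<in> I \<or> False)" by simp
  qed
  then obtain B where "\<forall>i\<in>X. pos (B i) \<and> B i \<subseteq> A i"
    "\<forall>i\<in>X. \<forall>j\<in>X. i \<noteq> j \<longrightarrow> B i \<inter> B j \<in> I" by auto
  then have B: "\<And>i. i \<in> X \<Longrightarrow> pos (B i) \<and> B i \<subseteq> A i"
    "\<And>i j. i \<in> X \<Longrightarrow> j \<in> X \<Longrightarrow> i \<noteq> j \<Longrightarrow> B i \<inter> B j \<in> I" by simp_all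
  obtain B' where B': "\<And>i. i \<in> X \<Longrightarrow> pos (B' i) \<and> B' i \<subseteq> B i"
    "\<And>i j. i \<in> X \<Longrightarrow> j \<in> X \<Longrightarrow> i \<noteq> j \<Longrightarrow> B i \<inter> B j \<in> I \<Longrightarrow> B' i \<inter> B' j = {}"
    using disjointify[of B] B(1) by blast
  show ?thesis
  proof (intro exI[of _ B'] conjI ballI impI)
    show "pos (B' i)" "B' i \<subseteq> A i" if "i \<in> X" for i using B'(1)[OF that] B(1)[OF that] by blast+
    show "B' i \<inter> B' j = {}" if "i \<in> X" "j \<in> X" "i \<noteq> j" for i j using B'(2)[OF that B(2)[OF that]] .
  qed
qed

end

section \<open>Regularity\<close>

lemma Field_Restr_wo: "Well_order s \<Longrightarrow> z \<subseteq> Field s \<Longrightarrow> Field (Restr s z) = z"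
  by (rule Refl_Field_Restr2) (auto simp: order_on_defs)

lemma card_le_Restr:
  assumes "Well_order s" "z \<subseteq> Field s"
  shows "|z| \<le>o Restr s z"
proof (rule card_of_least)
  have "Well_order (Restr s z)" by (rule Well_order_Restr[OF assms(1)])
  then show "well_order_on z (Restr s z)" unfolding Field_Restr_wo[OF assms] .
qed

text \<open>The cardinal of \<open>Z\<close> is at most the type of any well-order on
  \<open>Z\<close>, so \<open>r\<close> embeds onto an initial segment.\<close>

lemma subset_of_ordertype:
  assumes s: "Well_order s" "Z \<subseteq> Field s" and r: "r \<le>o |Z|"
  shows "\<exists>z\<subseteq>Z. Restr s z =o r"
proof -
  have "r \<le>o Restr s Z" using r card_le_Restr[OF s] ordLeq_transitive by blast
  then obtain f where wr: "Well_order r" "Well_order (Restr s Z)" and f: "embed r (Restr s Z) f"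
    unfolding ordLeq_def by auto
  have F: "Field (Restr s Z) = Z" by (rule Field_Restr_wo[OF s])
  let ?z = "f ` Field r"
  have z: "?z \<subseteq> Z" using embed_Field[OF f] F by simp
  have "iso r (Restr (Restr s Z) ?z) f" by (rule embed_implies_iso_Restr[OF wr(2,1) f])
  moreover have "Restr (Restr s Z) ?z = Restr s ?z" using z by auto
  ultimately have "iso r (Restr s ?z) f" by simp
  moreover have "Well_order (Restr s ?z)" by (rule Well_order_Restr[OF s(1)])
  ultimately have "r =o Restr s ?z" using wr(1) unfolding ordIso_def by auto
  then show ?thesis using z ordIso_symmetric by blast
qed

text \<open>Strictness makes \<open>r\<close> a proper initial segment of \<open>Z\<close>, cut off
  by an element \<open>a\<close>; this bound is what (iii) needs.\<close>

lemma bounded_subset_of_ordertype: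
  assumes s: "Well_order s" "Z \<subseteq> Field s" and r: "r <o |Z|"
  shows "\<exists>a\<in>Z. \<exists>z\<subseteq>Z \<inter> underS s a. Restr s z =o r"
proof -
  let ?s = "Restr s Z"
  have ws: "Well_order ?s" by (rule Well_order_Restr[OF s(1)])
  have F: "Field ?s = Z" by (rule Field_Restr_wo[OF s])
  have less: "r <o ?s" using r card_le_Restr[OF s] ordLess_ordLeq_trans by blast
  then have "Well_order r" unfolding ordLess_def by auto
  then obtain a where a: "a \<in> Z" "r =o Restr ?s (underS ?s a)"
    using ordLess_iff_ordIso_Restr[OF ws, of r] less F by auto
  have z: "underS ?s a \<subseteq> Z \<inter> underS s a" unfolding underS_def by auto
  then have "Restr ?s (underS ?s a) = Restr s (underS ?s a)" by auto
  then have "Restr s (underS ?s a) =o r" using a(2) ordIso_symmetric by auto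
  then show ?thesis using a(1) z by blast
qed

lemma regular2_pairwise_disjoint:
  fixes \<delta> :: "'i rel"
  assumes wo: "Well_order \<delta>"
    and ex: "\<And>A :: 'i \<Rightarrow> 'x set. \<forall>i\<in>Field \<delta>. A i \<in> positive_sets Y I \<Longrightarrow>
      \<exists>B. (\<forall>i\<in>Field \<delta>. B i \<in> positive_sets Y I \<and> B i \<subseteq> A i) \<and>
        (\<forall>i\<in>Field \<delta>. \<forall>j\<in>Field \<delta>. i \<noteq> j \<longrightarrow> B i \<inter> B j = {})"
  shows "regular2 Y I (natLeq_on 2) \<delta>"
  unfolding regular2_def
proof (intro allI impI)
  fix A :: "'i \<Rightarrow> 'x set" assume "\<forall>i\<in>Field \<delta>. A i \<in> positive_sets Y I"
  from ex[OF this] obtain B where B: "\<forall>i\<in>Field \<delta>. B i \<in> positive_sets Y I \<and> B i \<subseteq> A i"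
    "\<forall>i\<in>Field \<delta>. \<forall>j\<in>Field \<delta>. i \<noteq> j \<longrightarrow> B i \<inter> B j = {}" by (elim exE conjE)
  have "Y \<inter> (\<Inter>i\<in>z. B i) = {}" if z: "z \<subseteq> Field \<delta>" "Restr \<delta> z =o natLeq_on 2" for z
  proof -
    have "|Field (natLeq_on 2)| =o |Field (Restr \<delta> z)|" using z(2) card_of_cong ordIso_symmetric by blast
    then have "|{x::nat. x < 2}| =o |z|" by (simp only: Field_natLeq_on Field_Restr_wo[OF wo z(1)])
    then obtain f where f: "bij_betw f {x::nat. x < 2} z" using card_of_ordIso by blast
    have "f 0 \<in> z" "f 1 \<in> z" using f unfolding bij_betw_def by auto
    moreover have "f 0 \<noteq> f 1" using inj_onD[of f "{x::nat. x < 2}" 0 1] f unfolding bij_betw_def by auto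
    ultimately have "B (f 0) \<inter> B (f 1) = {}" using B(2) z(1) by blast
    then show ?thesis using \<open>f 0 \<in> z\<close> \<open>f 1 \<in> z\<close> by blast
  qed
  then show "\<exists>B. refinement (Field \<delta>) B A \<and> (\<forall>i\<in>Field \<delta>. B i \<in> positive_sets Y I) \<and>
           (\<forall>z. z \<subseteq> Field \<delta> \<and> Restr \<delta> z =o natLeq_on 2 \<longrightarrow> Y \<inter> (\<Inter>i\<in>z. B i) = {})"
    using B(1) unfolding refinement_def by (intro exI[of _ B]) simp
qed

section \<open>Part (i): regularity from the Ulam matrix and from ranks\<close>

context successor_ideal
begin

lemma regular2_below:
  fixes \<delta> :: "'i rel"
  assumes "Well_order \<delta>" "\<delta> <o \<kappa>"
  shows "regular2 X I (natLeq_on 2) \<delta>"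
proof (rule regular2_pairwise_disjoint[OF assms(1)])
  fix A :: "'i \<Rightarrow> 'a set set" assume A: "\<forall>i\<in>Field \<delta>. A i \<in> positive_sets X I"
  have "|Field \<delta>| <o \<kappa>" using card_of_least[OF assms(1)] assms(2) ordLeq_ordLess_trans by blast
  then have J: "|Field \<delta>| \<le>o \<mu>" using less_kappa_iff by blast
  show "\<exists>B. (\<forall>i\<in>Field \<delta>. B i \<in> positive_sets X I \<and> B i \<subseteq> A i) \<and>
        (\<forall>i\<in>Field \<delta>. \<forall>j\<in>Field \<delta>. i \<noteq> j \<longrightarrow> B i \<inter> B j = {})"
  proof (rule small_disjoint_refinement[OF J, of A])
    show "pos (A i)" if "i \<in> Field \<delta>" for i using A that by (simp add: pos_eq)
    fix B assume "\<And>i. i \<in> Field \<delta> \<Longrightarrow> pos (B i) \<and> B i \<subseteq> A i"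
      "\<And>i j. i \<in> Field \<delta> \<Longrightarrow> j \<in> Field \<delta> \<Longrightarrow> i \<noteq> j \<Longrightarrow> B i \<inter> B j = {}"
    then show ?thesis by (intro exI[of _ B]) (simp add: pos_eq)
  qed
qed

lemma ranked_inj:
  assumes z: "z \<subseteq> X" and x: "\<And>i. i \<in> z \<Longrightarrow> x \<in> B i"
    and rank: "\<And>i j. i \<in> X \<Longrightarrow> j \<in> X \<Longrightarrow> i \<in> underS \<kappa> j \<Longrightarrow> B i \<inter> B j = {} \<or> c i \<in> underS (cf \<mu>) (c j)"
  shows "inj_on c z"
proof (rule inj_onI, rule ccontr)
  fix i j assume ij: "i \<in> z" "j \<in> z" "c i = c j" "i \<noteq> j"
  have X: "i \<in> X" "j \<in> X" using ij z by auto
  have ne: "B i \<inter> B j \<noteq> {}" "B j \<inter> B i \<noteq> {}" using x ij by auto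
  have "i \<in> underS \<kappa> j \<or> j \<in> underS \<kappa> i"
    using wo_underS_or[OF kappa_wo X] ij(4) unfolding underS_def by auto
  then have "c i \<in> underS (cf \<mu>) (c j) \<or> c j \<in> underS (cf \<mu>) (c i)" using rank X ne by metis
  then show False using ij(3) unfolding underS_def by auto
qed

text \<open>A common point would put cf \<mu> many distinct ranks below the rank of the last index,
  but a proper initial segment of \<open>cf \<mu>\<close> is smaller than that.\<close>

lemma regular2_cf_suc: "regular2 X I (ordsuc (cf \<mu>)) \<kappa>"
  unfolding regular2_def
proof (intro allI impI)
  fix A assume "\<forall>i\<in>X. A i \<in> positive_sets X I"
  then have "\<forall>i\<in>X. pos (A i)" by (simp add: pos_eq)
  from ranked_refinement[OF this] obtain B c where
    B: "\<forall>i\<in>X. pos (B i) \<and> B i \<subseteq> A i \<and> c i \<in> Field (cf \<mu>)"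
    and rank: "\<forall>i\<in>X. \<forall>j\<in>X. i \<in> underS \<kappa> j \<longrightarrow> B i \<inter> B j = {} \<or> c i \<in> underS (cf \<mu>) (c j)"
    by (elim exE conjE)
  have "X \<inter> (\<Inter>i\<in>z. B i) = {}" if z: "z \<subseteq> X" "Restr \<kappa> z =o ordsuc (cf \<mu>)" for z
  proof (rule ccontr)
    assume "X \<inter> (\<Inter>i\<in>z. B i) \<noteq> {}"
    then obtain x where x: "\<And>i. i \<in> z \<Longrightarrow> x \<in> B i" by blast
    have Fz: "Field (Restr \<kappa> z) = z" by (rule Field_Restr_wo[OF kappa_wo z(1)])
    obtain g where g: "iso (ordsuc (cf \<mu>)) (Restr \<kappa> z) g"
      using ordIso_symmetric[OF z(2)] unfolding ordIso_def by auto
    have bij: "bij_betw g (insert None (Some ` Field (cf \<mu>))) z"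
      using g unfolding iso_def Fz Field_ordsuc by blast
    have comp: "compat (ordsuc (cf \<mu>)) (Restr \<kappa> z) g" using g unfolding iso_def by (blast intro: embed_compat)
    have gz: "g None \<in> z" "g (Some k) \<in> z" if "k \<in> Field (cf \<mu>)" for k
      using bij that unfolding bij_betw_def by auto
    obtain k0 where k0: "k0 \<in> Field (cf \<mu>)" using cf_infinite by fastforce
    have top: "g None \<in> z" by (rule gz(1)[OF k0])
    have lt: "c (g (Some k)) \<in> underS (cf \<mu>) (c (g None))" if k: "k \<in> Field (cf \<mu>)" for k
    proof -
      have "(Some k, None) \<in> ordsuc (cf \<mu>)" using k unfolding ordsuc_def by auto
      then have "(g (Some k), g None) \<in> \<kappa>" using comp unfolding compat_def by auto
      moreover have "g (Some k) \<noteq> g None" using bij k unfolding bij_betw_def inj_on_def by auto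
      ultimately have "g (Some k) \<in> underS \<kappa> (g None)" unfolding underS_def by auto
      moreover have "x \<in> B (g (Some k)) \<inter> B (g None)" using x gz[OF k] by auto
      moreover have "g (Some k) \<in> X" "g None \<in> X" using gz[OF k] z(1) by auto
      ultimately show ?thesis using rank by fastforce
    qed
    have inj: "inj_on c z" by (rule ranked_inj[OF z(1), of x B]) (use x rank in auto)
    have "inj_on (\<lambda>k. c (g (Some k))) (Field (cf \<mu>))"
    proof (rule inj_onI)
      fix k l assume kl: "k \<in> Field (cf \<mu>)" "l \<in> Field (cf \<mu>)" "c (g (Some k)) = c (g (Some l))"
      then have "g (Some k) = g (Some l)" using inj gz(2) unfolding inj_on_def by auto
      then show "k = l" using bij kl(1,2) unfolding bij_betw_def inj_on_def by auto
    qed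
    then have "|Field (cf \<mu>)| \<le>o |underS (cf \<mu>) (c (g None))|" by (rule card_le_inj) (use lt in auto)
    moreover have "c (g None) \<in> Field (cf \<mu>)" using B top z(1) by auto
    then have "|underS (cf \<mu>) (c (g None))| <o cf \<mu>" by (rule card_of_underS[OF cf_card])
    ultimately have "|Field (cf \<mu>)| <o cf \<mu>" using ordLeq_ordLess_trans by blast
    then show False using card_of_Field_ordIso[OF cf_card] not_ordLess_ordIso by blast
  qed
  then show "\<exists>B. refinement X B A \<and> (\<forall>i\<in>X. B i \<in> positive_sets X I) \<and>
           (\<forall>z. z \<subseteq> X \<and> Restr \<kappa> z =o ordsuc (cf \<mu>) \<longrightarrow> X \<inter> (\<Inter>i\<in>z. B i) = {})"
    using B unfolding refinement_def pos_eq by (intro exI[of _ B]) simp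
qed

text \<open>
  If \<open>y < x\<close> both lie in \<open>cf \<mu>\<close> many sets of a ranked refinement, then \<open>y \<in> below (c i) x\<close> for one of
  them, as the ranks are unbounded. The functions \<open>\<epsilon> i\<close> separate such pairs.
\<close>

lemma regular3_cf: "regular3 X I (natLeq_on 1) (cf \<mu>) \<kappa>"
  unfolding regular3_def
proof (intro allI impI)
  fix A assume "\<forall>i\<in>X. A i \<in> positive_sets X I"
  then have "\<forall>i\<in>X. pos (A i)" by (simp add: pos_eq)
  from ranked_refinement[OF this] obtain B c where
    B: "\<forall>i\<in>X. pos (B i) \<and> B i \<subseteq> A i \<and> c i \<in> Field (cf \<mu>)"
    and rank: "\<forall>i\<in>X. \<forall>j\<in>X. i \<in> underS \<kappa> j \<longrightarrow> B i \<inter> B j = {} \<or> c i \<in> underS (cf \<mu>) (c j)"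
    by (elim exE conjE)
  \<comment> \<open>Since \<open>below (c i) x\<close> has fewer than \<mu> elements, \<mu> colours
    suffice to give \<open>x\<close> a colour different from all of them. Fixing one colour on a
    positive part of \<open>B i\<close> then excludes such pairs.\<close>
  have "\<forall>i\<in>X. \<exists>\<epsilon>. \<forall>x\<in>X. \<epsilon> x \<in> Field \<mu> \<and> \<epsilon> x \<notin> \<epsilon> ` below (c i) x"
  proof
    fix i assume "i \<in> X"
    then have ci: "c i \<in> Field (cf \<mu>)" using B by auto
    show "\<exists>\<epsilon>. \<forall>x\<in>X. \<epsilon> x \<in> Field \<mu> \<and> \<epsilon> x \<notin> \<epsilon> ` below (c i) x"
    proof (rule wo_avoid[OF kappa_wo])
      fix x assume "x \<in> X"
      then show "|below (c i) x| <o |Field \<mu>|"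
        using below_less[OF _ ci] card_of_Field_ordIso[OF mu_card] ordIso_symmetric ordLess_ordIso_trans by blast
    qed (auto simp: below_def)
  qed
  from bchoice[OF this] obtain \<epsilon> where
    "\<forall>i\<in>X. \<forall>x\<in>X. \<epsilon> i x \<in> Field \<mu> \<and> \<epsilon> i x \<notin> \<epsilon> i ` below (c i) x" by (rule exE)
  then have eps: "\<epsilon> i x \<in> Field \<mu>" "\<epsilon> i x \<notin> \<epsilon> i ` below (c i) x" if "i \<in> X" "x \<in> X" for i x
    using that by auto
  have "\<forall>i\<in>X. \<exists>m. pos {x\<in>B i. \<epsilon> i x = m}"
  proof
    fix i assume i: "i \<in> X"
    then have Bi: "pos (B i)" using B by auto
    have "\<exists>m\<in>Field \<mu>. \<epsilon> i x = m" if "x \<in> B i" for x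
      using eps(1)[OF i] pos_sub[OF Bi] that by auto
    then show "\<exists>m. pos {x\<in>B i. \<epsilon> i x = m}"
      using pos_split[OF Bi Field_mu_le, of "\<lambda>x m. \<epsilon> i x = m"] by metis
  qed
  from bchoice[OF this] obtain m where m: "\<forall>i\<in>X. pos {x\<in>B i. \<epsilon> i x = m i}" by (rule exE)
  define B' where "B' i = {x\<in>B i. \<epsilon> i x = m i}" for i
  have less: False if z: "z \<subseteq> X" "Restr \<kappa> z =o cf \<mu>"
    and x: "x \<in> X" "\<And>i. i \<in> z \<Longrightarrow> x \<in> B' i" and y: "\<And>i. i \<in> z \<Longrightarrow> y \<in> B' i" and yx: "y \<in> underS \<kappa> x" for z x y
  proof -
    have "|Field (cf \<mu>)| =o |Field (Restr \<kappa> z)|" using z(2) card_of_cong ordIso_symmetric by blast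
    then have zc: "|Field (cf \<mu>)| =o |z|" by (simp only: Field_Restr_wo[OF kappa_wo z(1)])
    have r: "rk (e x y) \<in> Field (cf \<mu>)" using rk_Field e_Field[OF x(1)] by blast
    \<comment> \<open>Otherwise cf \<mu> many distinct ranks would fit into a proper initial segment
      of \<open>cf \<mu>\<close>.\<close>
    have "\<exists>i\<in>z. (rk (e x y), c i) \<in> cf \<mu>"
    proof (rule ccontr)
      assume n: "\<not> ?thesis"
      have "c i \<in> underS (cf \<mu>) (rk (e x y))" if "i \<in> z" for i
        using wo_underS_or[OF cf_wo r, of "c i"] n that B z(1) by auto
      moreover have "inj_on c z" by (rule ranked_inj[OF z(1), of x B]) (use x(2) rank in \<open>auto simp: B'_def\<close>)
      ultimately have "|z| \<le>o |underS (cf \<mu>) (rk (e x y))|" by (intro card_le_inj[of c]) auto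
      then have "|z| <o cf \<mu>" using card_of_underS[OF cf_card r] ordLeq_ordLess_trans by blast
      then have "|Field (cf \<mu>)| <o cf \<mu>" using zc ordIso_ordLess_trans by blast
      then show False using card_of_Field_ordIso[OF cf_card] not_ordLess_ordIso by blast
    qed
    then obtain i where i: "i \<in> z" "(rk (e x y), c i) \<in> cf \<mu>" by auto
    then have "y \<in> below (c i) x" using yx unfolding below_def by auto
    then have "\<epsilon> i y \<in> \<epsilon> i ` below (c i) x" by (rule imageI)
    moreover have "\<epsilon> i y = \<epsilon> i x" using x(2)[OF i(1)] y[OF i(1)] unfolding B'_def by auto
    moreover have "i \<in> X" using i(1) z(1) by auto
    ultimately show False using eps(2)[of i x] x(1) by simp
  qed
  have "|X \<inter> (\<Inter>i\<in>z. B' i)| \<le>o natLeq_on 1" if z: "z \<subseteq> X" "Restr \<kappa> z =o cf \<mu>" for z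
  proof -
    let ?S = "X \<inter> (\<Inter>i\<in>z. B' i)"
    have "x = y" if "x \<in> ?S" "y \<in> ?S" for x y
    proof (rule ccontr)
      assume "x \<noteq> y"
      then have "y \<in> underS \<kappa> x \<or> x \<in> underS \<kappa> y"
        using wo_underS_or[OF kappa_wo, of x y] that unfolding underS_def by auto
      then show False using less[OF z, of x y] less[OF z, of y x] that by blast
    qed
    then have "inj_on (\<lambda>x. 0::nat) ?S" unfolding inj_on_def by auto
    then have "|?S| \<le>o |{x::nat. x < 1}|" by (rule card_le_inj) auto
    then show ?thesis using card_of_least[OF natLeq_on_well_order_on] ordLeq_transitive by blast
  qed
  moreover have "refinement X B' A" using B unfolding refinement_def B'_def by auto
  moreover have "\<forall>i\<in>X. B' i \<in> positive_sets X I" using m by (simp add: pos_eq B'_def)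
  ultimately show "\<exists>B. refinement X B A \<and> (\<forall>i\<in>X. B i \<in> positive_sets X I) \<and>
           (\<forall>z. z \<subseteq> X \<and> Restr \<kappa> z =o cf \<mu> \<longrightarrow> |X \<inter> (\<Inter>i\<in>z. B i)| \<le>o natLeq_on 1)"
    by (intro exI[of _ B']) simp
qed

section \<open>Parts (ii) and (iii): from point-sparse to disjoint refinements\<close>

lemma regular2_of_point_sparse:
  assumes ex: "\<And>A. \<forall>i\<in>X. pos (A i) \<Longrightarrow> \<exists>B. (\<forall>i\<in>X. pos (B i) \<and> B i \<subseteq> A i) \<and> (\<forall>x\<in>X. |{i\<in>X. x \<in> B i}| <o cf \<mu>)"
  shows "regular2 X I (natLeq_on 2) \<kappa>"
proof (rule regular2_pairwise_disjoint[OF kappa_wo])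
  fix A assume "\<forall>i\<in>X. A i \<in> positive_sets X I"
  then have "\<forall>i\<in>X. pos (A i)" by (simp add: pos_eq)
  from ex[OF this] obtain B where B: "\<forall>i\<in>X. pos (B i) \<and> B i \<subseteq> A i" "\<forall>x\<in>X. |{i\<in>X. x \<in> B i}| <o cf \<mu>"
    by (elim exE conjE)
  have "\<exists>B'. (\<forall>i\<in>X. pos (B' i) \<and> B' i \<subseteq> B i) \<and> (\<forall>i\<in>X. \<forall>j\<in>X. i \<noteq> j \<longrightarrow> B' i \<inter> B' j = {})"
    by (rule point_sparse_refinement) (use B in auto)
  then obtain B' where "\<forall>i\<in>X. pos (B' i) \<and> B' i \<subseteq> B i" "\<forall>i\<in>X. \<forall>j\<in>X. i \<noteq> j \<longrightarrow> B' i \<inter> B' j = {}"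
    by (elim exE conjE)
  moreover from this(1) B(1) have "\<forall>i\<in>X. pos (B' i) \<and> B' i \<subseteq> A i" by (meson subset_trans)
  ultimately show "\<exists>B. (\<forall>i\<in>X. B i \<in> positive_sets X I \<and> B i \<subseteq> A i) \<and> (\<forall>i\<in>X. \<forall>j\<in>X. i \<noteq> j \<longrightarrow> B i \<inter> B j = {})"
    unfolding pos_eq by (intro exI[of _ B']) simp
qed

text \<open>A point in at least cf \<mu> many sets would lie in a subfamily whose indices have type
  exactly cf \<mu>.\<close>

lemma regular2_of_cf:
  assumes reg: "regular2 X I (cf \<mu>) \<kappa>"
  shows "regular2 X I (natLeq_on 2) \<kappa>"
proof (rule regular2_of_point_sparse)
  fix A assume "\<forall>i\<in>X. pos (A i)"
  then have "\<forall>i\<in>X. A i \<in> positive_sets X I" by (simp add: pos_eq)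
  from reg[unfolded regular2_def, THEN spec, THEN mp, OF this]
  obtain B where B: "refinement X B A" "\<forall>i\<in>X. B i \<in> positive_sets X I"
    "\<forall>z. z \<subseteq> X \<and> Restr \<kappa> z =o cf \<mu> \<longrightarrow> X \<inter> (\<Inter>i\<in>z. B i) = {}"
    by (elim exE conjE)
  have "|{i\<in>X. x \<in> B i}| <o cf \<mu>" if x: "x \<in> X" for x
  proof (rule ccontr)
    let ?Z = "{i\<in>X. x \<in> B i}"
    assume "\<not> |?Z| <o cf \<mu>"
    then have "cf \<mu> \<le>o |?Z|" using not_card_less_iff[OF cf_card] by blast
    then obtain z where z: "z \<subseteq> ?Z" "Restr \<kappa> z =o cf \<mu>"
      using subset_of_ordertype[OF kappa_wo, of ?Z] by auto
    moreover have "z \<subseteq> X" using z(1) by auto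
    ultimately have "X \<inter> (\<Inter>i\<in>z. B i) = {}" using B(3) by simp
    then show False using z(1) x by auto
  qed
  then show "\<exists>B. (\<forall>i\<in>X. pos (B i) \<and> B i \<subseteq> A i) \<and> (\<forall>x\<in>X. |{i\<in>X. x \<in> B i}| <o cf \<mu>)"
    using B(1,2) unfolding refinement_def pos_eq by (intro exI[of _ B]) simp
qed

text \<open>Koenig's diagonal argument. Otherwise \<open>h\<close> assigns coordinates in
  \<open>K\<close> to the elements of a cofinal set. The functions listed by \<open>F\<close> before
  \<open>k\<close> are fewer than \<mu>, so they miss a value \<open>v k\<close> at
  \<open>h k\<close>. The function with all these values is itself listed before some
  \<open>k\<close>.\<close>

lemma koenig_cf:
  assumes le: "|Func K (Field \<mu>)| \<le>o \<mu>"
  shows "|K| <o cf \<mu>"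
proof (rule ccontr)
  assume "\<not> |K| <o cf \<mu>"
  then have "cf \<mu> \<le>o |K|" using not_card_less_iff[OF cf_card] by blast
  then have "|Field (cf \<mu>)| \<le>o |K|"
    using card_of_Field_ordIso[OF cf_card] ordIso_ordLeq_trans by blast
  then obtain h where h: "inj_on h (Field (cf \<mu>))" "h ` Field (cf \<mu>) \<subseteq> K" using card_of_ordLeq by metis
  have "|Func K (Field \<mu>)| \<le>o |Field \<mu>|"
    using le card_of_Field_ordIso[OF mu_card] ordIso_symmetric ordLeq_ordIso_trans by blast
  then obtain F where F: "inj_on F (Func K (Field \<mu>))" "F ` Func K (Field \<mu>) \<subseteq> Field \<mu>" using card_of_ordLeq by metis
  define D where "D k = {f\<in>Func K (Field \<mu>). F f \<in> underS \<mu> k}" for k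
  have "\<exists>v\<in>Field \<mu>. k \<in> Field \<mu> \<longrightarrow> v \<notin> (\<lambda>f. f (h k)) ` D k" for k
  proof (cases "k \<in> Field \<mu>")
    case True
    have "inj_on F (D k)" by (rule inj_on_subset[OF F(1)]) (auto simp: D_def)
    then have "|D k| \<le>o |underS \<mu> k|" by (rule card_le_inj) (auto simp: D_def)
    then have "|D k| <o \<mu>" using card_of_underS[OF mu_card True] ordLeq_ordLess_trans by blast
    then have l: "|(\<lambda>f. f (h k)) ` D k| <o \<mu>" using card_of_image ordLeq_ordLess_trans by blast
    have "\<not> Field \<mu> \<subseteq> (\<lambda>f. f (h k)) ` D k"
    proof
      assume "Field \<mu> \<subseteq> (\<lambda>f. f (h k)) ` D k"
      then have "|Field \<mu>| <o \<mu>" using l by (rule card_less_subset)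
      then show False using card_of_Field_ordIso[OF mu_card] not_ordLess_ordIso by blast
    qed
    then show ?thesis by auto
  next
    case False
    moreover obtain v where "v \<in> Field \<mu>" using mu_inf by fastforce
    ultimately show ?thesis by auto
  qed
  then obtain v where v: "\<And>k. v k \<in> Field \<mu>" "\<And>k. k \<in> Field \<mu> \<Longrightarrow> v k \<notin> (\<lambda>f. f (h k)) ` D k" by metis
  define f where "f b = (if b \<in> K then v (inv_into (Field (cf \<mu>)) h b) else undefined)" for b
  have f: "f \<in> Func K (Field \<mu>)" unfolding Func_def f_def using v(1) by auto
  then have "F f \<in> Field \<mu>" using F(2) by auto
  then obtain k where k: "k \<in> Field (cf \<mu>)" "F f \<in> underS \<mu> k"
    using cf_cofinal unfolding cofinal_def underS_def by auto
  have "f (h k) = v k" unfolding f_def using h k(1) by auto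
  moreover have "f \<in> D k" using f k(2) unfolding D_def by auto
  ultimately have "v k \<in> (\<lambda>f. f (h k)) ` D k" by (metis imageI)
  then show False using v(2) k(1) cf_Field by blast
qed

text \<open>Composing an enumeration of \<open>y\<close> by \<open>Field \<beta>\<close> with
  \<open>e i\<close> codes \<open>y\<close> by a function into \<mu>, whose range determines
  \<open>y\<close> because \<open>e i\<close> is injective below \<open>i\<close>.\<close>

lemma card_subsets_of_ordertype:
  assumes le: "|Func (Field \<beta>) (Field \<mu>)| \<le>o \<mu>" and i: "i \<in> X"
  shows "|{y. y \<subseteq> underS \<kappa> i \<and> Restr \<kappa> y =o \<beta>}| \<le>o \<mu>"
proof -
  let ?Y = "{y. y \<subseteq> underS \<kappa> i \<and> Restr \<kappa> y =o \<beta>}"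
  have yX: "y \<subseteq> X" if "y \<in> ?Y" for y using that in_underS_Field[of _ \<kappa> i] by auto
  have "\<forall>y\<in>?Y. \<exists>f. bij_betw f (Field \<beta>) y"
  proof
    fix y assume y: "y \<in> ?Y"
    then have "|Field \<beta>| =o |Field (Restr \<kappa> y)|" using card_of_cong ordIso_symmetric by blast
    then have "|Field \<beta>| =o |y|" by (simp only: Field_Restr_wo[OF kappa_wo yX[OF y]])
    then show "\<exists>f. bij_betw f (Field \<beta>) y" using card_of_ordIso by blast
  qed
  from bchoice[OF this] obtain f where f: "\<forall>y\<in>?Y. bij_betw (f y) (Field \<beta>) y" by (rule exE)
  define G where "G y b = (if b \<in> Field \<beta> then e i (f y b) else undefined)" for y b
  have img: "G y ` Field \<beta> = e i ` y" if "y \<in> ?Y" for y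
  proof -
    have "f y ` Field \<beta> = y" using f that unfolding bij_betw_def by blast
    then have "e i ` f y ` Field \<beta> = e i ` y" by simp
    then show ?thesis unfolding G_def image_image by simp
  qed
  have "inj_on G ?Y"
  proof (rule inj_onI)
    fix y y' assume y: "y \<in> ?Y" "y' \<in> ?Y" "G y = G y'"
    then have "e i ` y = e i ` y'" using img[OF y(1)] img[OF y(2)] by simp
    then show "y = y'" using inj_on_image_eq_iff[OF e_inj[OF i], of y y'] y(1,2) by simp
  qed
  then have "|?Y| \<le>o |Func (Field \<beta>) (Field \<mu>)|"
    by (rule card_le_inj) (use e_Field[OF i] in \<open>auto simp: Func_def G_def\<close>)
  then show ?thesis using le ordLeq_transitive by blast
qed

text \<open>\<open>N i\<close> is a union of at most \<mu> sets of size at most \<mu>, hence null.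
  Once it is removed, no point of \<open>B' i\<close> lies in sets \<open>B j\<close> for a set of
  type \<beta> of indices \<open>j\<close> below \<open>i\<close>.\<close>

lemma regular2_of_regular3:
  fixes \<alpha> :: "'b rel" and \<beta> :: "'c rel"
  assumes al: "\<alpha> <o \<kappa>" and be: "Well_order \<beta>" and exp: "\<mu> ^c \<beta> =o \<mu>" and reg: "regular3 X I \<alpha> \<beta> \<kappa>"
  shows "regular2 X I (natLeq_on 2) \<kappa>"
proof (rule regular2_of_point_sparse)
  fix A assume "\<forall>i\<in>X. pos (A i)"
  then have "\<forall>i\<in>X. A i \<in> positive_sets X I" by (simp add: pos_eq)
  from reg[unfolded regular3_def, THEN spec, THEN mp, OF this]
  obtain B where B: "refinement X B A" "\<forall>i\<in>X. B i \<in> positive_sets X I"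
    "\<forall>z. z \<subseteq> X \<and> Restr \<kappa> z =o \<beta> \<longrightarrow> |X \<inter> (\<Inter>i\<in>z. B i)| \<le>o \<alpha>"
    by (elim exE conjE)
  have le: "|Func (Field \<beta>) (Field \<mu>)| \<le>o \<mu>"
    using exp ordIso_imp_ordLeq unfolding cexp_def by blast
  have "|Field \<beta>| <o cf \<mu>" by (rule koenig_cf[OF le])
  \<comment> \<open>The ordinal \<beta> may exceed its cardinality, but it stays below the initial
    ordinal \<open>cf \<mu>\<close>.\<close>
  have bcf: "\<beta> <o cf \<mu>"
  proof (rule ccontr)
    assume "\<not> \<beta> <o cf \<mu>"
    then have "cf \<mu> \<le>o \<beta>" using not_ordLess_iff_ordLeq[OF cf_wo be] by blast
    then have "|Field (cf \<mu>)| \<le>o |Field \<beta>|" by (rule card_of_mono2)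
    then have "|Field (cf \<mu>)| <o cf \<mu>" using \<open>|Field \<beta>| <o cf \<mu>\<close> ordLeq_ordLess_trans by blast
    then show False using card_of_Field_ordIso[OF cf_card] not_ordLess_ordIso by blast
  qed
  define Y where "Y i = {y. y \<subseteq> underS \<kappa> i \<and> Restr \<kappa> y =o \<beta>}" for i
  define N where "N i = (\<Union>y\<in>Y i. X \<inter> (\<Inter>j\<in>y. B j))" for i
  have N: "N i \<in> I" if i: "i \<in> X" for i
  proof (rule null_small)
    show "N i \<subseteq> X" unfolding N_def by auto
    show "|N i| \<le>o \<mu>" unfolding N_def
    proof (rule card_le_UN[OF mu])
      show "|Y i| \<le>o \<mu>" unfolding Y_def by (rule card_subsets_of_ordertype[OF le i])
      fix y assume y: "y \<in> Y i"
      then have "y \<subseteq> X" unfolding Y_def using in_underS_Field[of _ \<kappa> i] by auto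
      then have "|X \<inter> (\<Inter>j\<in>y. B j)| \<le>o \<alpha>" using B(3) y unfolding Y_def by auto
      then show "|X \<inter> (\<Inter>j\<in>y. B j)| \<le>o \<mu>" using al ordLeq_ordLess_trans less_kappa_iff by blast
    qed
  qed
  define B' where "B' i = B i - N i" for i
  have "pos (B' i) \<and> B' i \<subseteq> A i" if i: "i \<in> X" for i
  proof
    show "pos (B' i)" by (rule pos_diff[OF _ N[OF i], of "B i"]) (use B(2) i in \<open>auto simp: B'_def pos_eq\<close>)
    show "B' i \<subseteq> A i" using B(1) i unfolding refinement_def B'_def by auto
  qed
  moreover have "|{i\<in>X. x \<in> B' i}| <o cf \<mu>" if x: "x \<in> X" for x
  proof (rule ccontr)
    let ?Z = "{i\<in>X. x \<in> B' i}"
    assume "\<not> |?Z| <o cf \<mu>"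
    then have "cf \<mu> \<le>o |?Z|" using not_card_less_iff[OF cf_card] by blast
    \<comment> \<open>As \<beta> is strictly smaller, there is an index \<open>a\<close> after a set
      of type \<beta>, and \<open>x\<close> was removed from \<open>B' a\<close>.\<close>
    then have bZ: "\<beta> <o |?Z|" using bcf ordLess_ordLeq_trans by blast
    have "?Z \<subseteq> X" by auto
    from bounded_subset_of_ordertype[OF kappa_wo this bZ]
    obtain a z where a: "a \<in> ?Z" and z: "z \<subseteq> ?Z \<inter> underS \<kappa> a" "Restr \<kappa> z =o \<beta>"
      by (elim bexE exE conjE)
    have "z \<in> Y a" using z unfolding Y_def by auto
    moreover have "x \<in> X \<inter> (\<Inter>j\<in>z. B j)" using x z(1) unfolding B'_def by auto
    ultimately have "x \<in> N a" unfolding N_def by (rule UN_I)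
    then show False using a unfolding B'_def by auto
  qed
  ultimately show "\<exists>B. (\<forall>i\<in>X. pos (B i) \<and> B i \<subseteq> A i) \<and> (\<forall>x\<in>X. |{i\<in>X. x \<in> B i}| <o cf \<mu>)"
    by (intro exI[of _ B']) simp
qed

end

theorem theorem2:
  fixes \<mu> :: "'a rel" and \<kappa> :: "'a set rel" and I :: "'a set set set"
  assumes "Cinfinite \<mu>"
    and "\<kappa> = cardSuc \<mu>"
    and "ideal_on (Field \<kappa>) I"
    and "proper_ideal (Field \<kappa>) I"
    and "nonprincipal_ideal (Field \<kappa>) I"
    and "complete_ideal \<kappa> I"
  shows "(regular2 (Field \<kappa>) I (ordsuc (cf \<mu>)) \<kappa>
          \<and> regular3 (Field \<kappa>) I (natLeq_on 1) (cf \<mu>) \<kappa>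
          \<and> (\<forall>\<delta> :: 'a set rel. Well_order \<delta> \<and> \<delta> <o \<kappa> \<longrightarrow> regular2 (Field \<kappa>) I (natLeq_on 2) \<delta>))
     \<and> (regular2 (Field \<kappa>) I (cf \<mu>) \<kappa> \<longrightarrow> regular2 (Field \<kappa>) I (natLeq_on 2) \<kappa>)
     \<and> ((\<exists>(\<alpha> :: 'a set rel) (\<beta> :: 'a set rel). Well_order \<alpha> \<and> \<alpha> <o \<kappa> \<and> Well_order \<beta> \<and> \<beta> <o \<kappa>
            \<and> \<mu> ^c \<beta> =o \<mu> \<and> regular3 (Field \<kappa>) I \<alpha> \<beta> \<kappa>)
          \<longrightarrow> regular2 (Field \<kappa>) I (natLeq_on 2) \<kappa>)"
proof -
  interpret successor_ideal \<mu> \<kappa> I using assms by unfold_locales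
  show ?thesis
    using regular2_cf_suc regular3_cf regular2_below regular2_of_cf regular2_of_regular3 by blast
qed

end
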